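(* Let $\mathsf{k}$ be a field. There is an isomorphism of props $$\Phi\colon \mathsf{Corel}\,\mathsf{Mat}\,\mathsf{k}[s,s^{-1}] \longrightarrow \mathsf{LTI}$$ taking a corelation $m\xrightarrow{A} d\xleftarrow{B} n$ to the LTI behaviour $$\{(\mathbf{x},\mathbf{y})\in(\mathsf{k}^m)^{\mathbb Z}\oplus(\mathsf{k}^n)^{\mathbb Z}\mid (\theta A)\mathbf{x}=(\theta B)\mathbf{y}\}=\ker\theta[A\ \ {-B}].$$
   Context: A prop is a strict symmetric monoidal category whose objects are the natural numbers with monoidal product on objects given by addition; morphisms of props are identity-on-objects strict symmetric monoidal functors. $\mathsf{k}$ is a field. $\mathsf{Mat}\,\mathsf{k}[s,s^{-1}]$ is the prop whose arrows $m\to n$ are $n\times m$ matrices over the Laurent polynomial ring $\mathsf{k}[s,s^{-1}]$, with matrix multiplication as composition, block-diagonal sum as monoidal product, and permutation matrices as symmetries. It has finite colimits, since $\mathsf{k}[s,s^{-1}]$ is a PID and the category is equivalent to finite-rank free modules. Action: for $w\in \mathsf{k}^{\mathbb Z}$, $(s\cdot w)(t)=w(t-1)$ and $(s^{-1}\cdot w)(t)=w(t+1)$, extended linearly to all Laurent polynomials. The functor $\theta\colon \mathsf{Mat}\,\mathsf{k}[s,s^{-1}]\to\mathsf{Vect}_{\mathsf{k}}$ sends $n$ to $(\mathsf{k}^n)^{\mathbb Z}$ and an $n\times m$ matrix to the induced $\mathsf{k}$-linear map $(\mathsf{k}^m)^{\mathbb Z}\to(\mathsf{k}^n)^{\mathbb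 Z}$. Every morphism of $\mathsf{Mat}\,\mathsf{k}[s,s^{-1}]$ factors as an epi followed by a split mono; epis and split monos form a factorisation system with split monos stable under pushout. The prop $\mathsf{Corel}\,\mathsf{Mat}\,\mathsf{k}[s,s^{-1}]$ has as morphisms $m\to n$ the isomorphism classes of jointly-epic cospans (corelations) $m\xrightarrow{A} d\xleftarrow{B} n$, i.e. those for which the copairing $[A\ B]\colon m+n\to d$ is an epimorphism in $\mathsf{Mat}\,\mathsf{k}[s,s^{-1}]$. Composition: compose by pushout to obtain a cospan $m\xrightarrow{A} d\xleftarrow{B} n$, factor $[A\ B]$ as an epi $[A'\ B']$ followed by a split mono, and take the corelation given by $A',B'$. The monoidal product is induced by that of matrices. A subset $\mathscr B\subseteq(\mathsf{k}^q)^{\mathbb Z}$ is linear if it is a $\mathsf{k}$-linear subspace; time-invariant if $w\in\mathscr B$, $i\in\mathbb Z$ imply that $t\mapsto w(t+i)$ is in $\mathscr B$; complete if any $w\in(\mathsf{k}^q)^{\mathbb Z}$ satisfying $w|_{[t_0,t_1]}\in\mathscr B|_{[t_0,t_1]}$ for all integers $t_0\le t_1$ lies in $\mathscr B$ (where $\mathscr B|_{[t_0,t_1]}$ is the set of restrictions of elements of $\mathscr B$ to $\{t_0,\dots,t_1\}$). An LTI behaviour $m\to n$ is a subset $\mathscr B\subseteq(\mathsf{k}^m)^{\mathbb Z}\oplus(\mathsf{k}^n)^{\mathbb Z}\cong(\mathsf{k}^m\oplus \mathsf{k}^n)^{\mathbb Z}$ that is linear, time-invariant and complete. $\mathsf{LTI}$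 is the prop whose morphisms $m\to n$ are the LTI behaviours $m\to n$, with relational composition and direct sum as monoidal product. *)

theory Defs
  imports "HOL-Library.Poly_Mapping" "HOL-Library.FuncSet" "Jordan_Normal_Form.Matrix"
begin

section \<open>Props\<close>

text \<open>
  A prop has the natural numbers as objects, so its data are the hom-sets indexed by pairs of
  numbers, composition (\<open>Cmp P g f\<close> is \<open>g\<close> after \<open>f\<close>), identities, the monoidal product of arrows,
  and the symmetries \<open>m + n \<rightarrow> n + m\<close>.
  Composition and monoidal product carry no object indices; this loses no generality because
  hom-sets with different indices are required to be disjoint.
\<close>

record 'a prop_data =
  Hom :: "nat \<Rightarrow> nat \<Rightarrow> 'a set"
  Cmp :: "'a \<Rightarrow> 'a \<Rightarrow> 'a"
  Idn :: "nat \<Rightarrow> 'a"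
  Tns :: "'a \<Rightarrow> 'a \<Rightarrow> 'a"
  Sym :: "nat \<Rightarrow> nat \<Rightarrow> 'a"

locale prop_category =
  fixes P :: "'a prop_data"
  assumes Hom_disjoint: "(m, n) \<noteq> (m', n') \<Longrightarrow> Hom P m n \<inter> Hom P m' n' = {}"
    and Idn_in_Hom: "Idn P n \<in> Hom P n n"
    and Cmp_in_Hom: "\<lbrakk>f \<in> Hom P l m; g \<in> Hom P m n\<rbrakk> \<Longrightarrow> Cmp P g f \<in> Hom P l n"
    and Cmp_assoc: "\<lbrakk>f \<in> Hom P k l; g \<in> Hom P l m; h \<in> Hom P m n\<rbrakk>
          \<Longrightarrow> Cmp P (Cmp P h g) f = Cmp P h (Cmp P g f)"
    and Cmp_Idn_left: "f \<in> Hom P m n \<Longrightarrow> Cmp P (Idn P n) f = f"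
    and Cmp_Idn_right: "f \<in> Hom P m n \<Longrightarrow> Cmp P f (Idn P m) = f"
    and Tns_in_Hom: "\<lbrakk>f \<in> Hom P m n; f' \<in> Hom P m' n'\<rbrakk>
          \<Longrightarrow> Tns P f f' \<in> Hom P (m + m') (n + n')"
    and Tns_Idn: "Tns P (Idn P m) (Idn P n) = Idn P (m + n)"
    and Tns_Cmp: "\<lbrakk>f \<in> Hom P l m; g \<in> Hom P m n; f' \<in> Hom P l' m'; g' \<in> Hom P m' n'\<rbrakk>
          \<Longrightarrow> Tns P (Cmp P g f) (Cmp P g' f') = Cmp P (Tns P g g') (Tns P f f')"
    and Tns_assoc: "\<lbrakk>f \<in> Hom P m n; f' \<in> Hom P m' n'; f'' \<in> Hom P m'' n''\<rbrakk>
          \<Longrightarrow> Tns P (Tns P f f') f'' = Tns P f (Tns P f' f'')"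
    and Tns_unit_left: "f \<in> Hom P m n \<Longrightarrow> Tns P (Idn P 0) f = f"
    and Tns_unit_right: "f \<in> Hom P m n \<Longrightarrow> Tns P f (Idn P 0) = f"
    and Sym_in_Hom: "Sym P m n \<in> Hom P (m + n) (n + m)"
    and Sym_natural: "\<lbrakk>f \<in> Hom P m n; f' \<in> Hom P m' n'\<rbrakk>
          \<Longrightarrow> Cmp P (Sym P n n') (Tns P f f') = Cmp P (Tns P f' f) (Sym P m m')"
    and Sym_Sym: "Cmp P (Sym P n m) (Sym P m n) = Idn P (m + n)"
    and Sym_hexagon: "Sym P (l + m) n
          = Cmp P (Tns P (Sym P l n) (Idn P m)) (Tns P (Idn P l) (Sym P m n))"

text \<open>An identity-on-objects strict symmetric monoidal functor is given by its action on arrows.\<close>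

locale prop_morphism = P: prop_category P + Q: prop_category Q
  for P :: "'a prop_data" and Q :: "'b prop_data" +
  fixes F :: "nat \<Rightarrow> nat \<Rightarrow> 'a \<Rightarrow> 'b"
  assumes F_in_Hom: "f \<in> Hom P m n \<Longrightarrow> F m n f \<in> Hom Q m n"
    and F_Idn: "F n n (Idn P n) = Idn Q n"
    and F_Cmp: "\<lbrakk>f \<in> Hom P l m; g \<in> Hom P m n\<rbrakk>
          \<Longrightarrow> F l n (Cmp P g f) = Cmp Q (F m n g) (F l m f)"
    and F_Tns: "\<lbrakk>f \<in> Hom P m n; f' \<in> Hom P m' n'\<rbrakk>
          \<Longrightarrow> F (m + m') (n + n') (Tns P f f') = Tns Q (F m n f) (F m' n' f')"
    and F_Sym: "F (m + n) (n + m) (Sym P m n) = Sym Q m n"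

definition prop_isomorphism ::
  "'a prop_data \<Rightarrow> 'b prop_data \<Rightarrow> (nat \<Rightarrow> nat \<Rightarrow> 'a \<Rightarrow> 'b) \<Rightarrow> bool" where
  "prop_isomorphism P Q F \<longleftrightarrow> prop_morphism P Q F \<and>
     (\<exists>G. prop_morphism Q P G \<and>
       (\<forall>m n. \<forall>f \<in> Hom P m n. G m n (F m n f) = f) \<and>
       (\<forall>m n. \<forall>g \<in> Hom Q m n. F m n (G m n g) = g))"

definition epi :: "'a prop_data \<Rightarrow> nat \<Rightarrow> nat \<Rightarrow> 'a \<Rightarrow> bool" where
  "epi P m n f \<longleftrightarrow> f \<in> Hom P m n \<and>
     (\<forall>p. \<forall>g \<in> Hom P n p. \<forall>h \<in> Hom P n p. Cmp P g f = Cmp P h f \<longrightarrow> g = h)"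

definition split_mono :: "'a prop_data \<Rightarrow> nat \<Rightarrow> nat \<Rightarrow> 'a \<Rightarrow> bool" where
  "split_mono P m n f \<longleftrightarrow> f \<in> Hom P m n \<and> (\<exists>r \<in> Hom P n m. Cmp P r f = Idn P m)"

definition iso_arrow :: "'a prop_data \<Rightarrow> nat \<Rightarrow> nat \<Rightarrow> 'a \<Rightarrow> bool" where
  "iso_arrow P m n f \<longleftrightarrow> f \<in> Hom P m n \<and>
     (\<exists>g \<in> Hom P n m. Cmp P g f = Idn P m \<and> Cmp P f g = Idn P n)"

text \<open>\<open>a \<midarrow>p\<rightarrow> d \<midarrow>q\<leftarrow> b\<close> is a pushout of the span \<open>a \<midarrow>f\<leftarrow> n \<midarrow>g\<rightarrow> b\<close>.\<close>

definition is_pushout ::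
  "'a prop_data \<Rightarrow> nat \<Rightarrow> nat \<Rightarrow> nat \<Rightarrow> nat \<Rightarrow> 'a \<Rightarrow> 'a \<Rightarrow> 'a \<Rightarrow> 'a \<Rightarrow> bool" where
  "is_pushout P n a b d f g p q \<longleftrightarrow>
     f \<in> Hom P n a \<and> g \<in> Hom P n b \<and> p \<in> Hom P a d \<and> q \<in> Hom P b d \<and>
     Cmp P p f = Cmp P q g \<and>
     (\<forall>e. \<forall>p' \<in> Hom P a e. \<forall>q' \<in> Hom P b e. Cmp P p' f = Cmp P q' g \<longrightarrow>
        (\<exists>!u. u \<in> Hom P d e \<and> Cmp P u p = p' \<and> Cmp P u q = q'))"


section \<open>Matrices over Laurent polynomials\<close>

text \<open>
  The Laurent polynomial ring is the group algebra of the integers: finitely supported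
  functions on \<open>int\<close> with convolution product, \<open>s\<close> being \<open>Poly_Mapping.single 1 1\<close>.
\<close>

type_synonym 'k laurent = "int \<Rightarrow>\<^sub>0 'k"

definition block_diag :: "'a::zero mat \<Rightarrow> 'a mat \<Rightarrow> 'a mat" where
  "block_diag A B =
     four_block_mat A (0\<^sub>m (dim_row A) (dim_col B)) (0\<^sub>m (dim_row B) (dim_col A)) B"

definition swap_mat :: "nat \<Rightarrow> nat \<Rightarrow> 'a::{zero,one} mat" where
  "swap_mat m n = four_block_mat (0\<^sub>m n m) (1\<^sub>m n) (1\<^sub>m m) (0\<^sub>m m n)"

definition Mat :: "'k::field laurent mat prop_data" where
  "Mat = \<lparr> Hom = (\<lambda>m n. carrier_mat n m),
           Cmp = (\<lambda>B A. B * A),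
           Idn = (\<lambda>n. 1\<^sub>m n),
           Tns = block_diag,
           Sym = swap_mat \<rparr>"

text \<open>The copairing \<open>[A B]\<close> of two matrices with the same number of rows.\<close>

definition copair :: "'a::zero mat \<Rightarrow> 'a mat \<Rightarrow> 'a mat" where
  "copair A B = four_block_mat A B (0\<^sub>m 0 (dim_col A)) (0\<^sub>m 0 (dim_col B))"


section \<open>Corelations\<close>

text \<open>A cospan \<open>m \<midarrow>A\<rightarrow> d \<midarrow>B\<leftarrow> n\<close> is the pair \<open>(A, B)\<close>; the matrices determine \<open>m\<close>, \<open>n\<close> and \<open>d\<close>.\<close>

type_synonym 'k cospan = "'k laurent mat \<times> 'k laurent mat"

definition jointly_epic :: "nat \<Rightarrow> nat \<Rightarrow> nat \<Rightarrow> 'k::field laurent mat \<Rightarrow> 'k laurent mat \<Rightarrow> bool" where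
  "jointly_epic m n d A B \<longleftrightarrow>
     A \<in> Hom Mat m d \<and> B \<in> Hom Mat n d \<and> epi Mat (m + n) d (copair A B)"

definition cospan_iso :: "'k::field cospan \<Rightarrow> 'k cospan \<Rightarrow> bool" where
  "cospan_iso = (\<lambda>(A, B) (A', B'). \<exists>m n d d' U.
     A \<in> Hom Mat m d \<and> B \<in> Hom Mat n d \<and> iso_arrow Mat d d' U \<and>
     A' = Cmp Mat U A \<and> B' = Cmp Mat U B)"

definition corel_class :: "'k::field laurent mat \<Rightarrow> 'k laurent mat \<Rightarrow> 'k cospan set" where
  "corel_class A B = {c. cospan_iso (A, B) c}"

text \<open>
  \<open>corel_composite (A, B) (C, D) (A', B')\<close>: the cospan \<open>(A', B')\<close> arises by forming some pushout
  of \<open>a \<midarrow>B\<leftarrow> n \<midarrow>C\<rightarrow> b\<close> and taking the epi part of some factorisation of the copairing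
  of the composite cospan as an epi followed by a split mono \<open>M\<close>.
\<close>

definition corel_composite ::
  "'k::field cospan \<Rightarrow> 'k cospan \<Rightarrow> 'k cospan \<Rightarrow> bool" where
  "corel_composite = (\<lambda>(A, B) (C, D) (A', B'). \<exists>m n l a b e d P Q M.
     A \<in> Hom Mat m a \<and> B \<in> Hom Mat n a \<and> C \<in> Hom Mat n b \<and> D \<in> Hom Mat l b \<and>
     is_pushout Mat n a b e B C P Q \<and>
     jointly_epic m l d A' B' \<and> split_mono Mat d e M \<and>
     Cmp Mat M (copair A' B') = copair (Cmp Mat P A) (Cmp Mat Q D))"

text \<open>
  Arrows are isomorphism classes of corelations, represented as sets of cospans. The operations
  collect the outcomes of all choices of representatives, pushouts and factorisations; these
  outcomes form a single isomorphism class. Identities and symmetries are the images of those of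
  \<open>Mat\<close> under the embedding taking \<open>f\<close> to the corelation with legs \<open>f\<close> and an identity.
\<close>

definition Corel_Mat :: "'k::field cospan set prop_data" where
  "Corel_Mat = \<lparr>
     Hom = (\<lambda>m n. {corel_class A B | A B. \<exists>d. jointly_epic m n d A B}),
     Cmp = (\<lambda>Y X. {c. \<exists>x \<in> X. \<exists>y \<in> Y. corel_composite x y c}),
     Idn = (\<lambda>n. corel_class (Idn Mat n) (Idn Mat n)),
     Tns = (\<lambda>X Y. \<Union>(A, B) \<in> X. \<Union>(C, D) \<in> Y. corel_class (Tns Mat A C) (Tns Mat B D)),
     Sym = (\<lambda>m n. corel_class (Sym Mat m n) (Idn Mat (n + m))) \<rparr>"


section \<open>Linear time-invariant behaviours\<close>

definition traj :: "nat \<Rightarrow> (int \<Rightarrow> 'k vec) set" where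
  "traj q = {w. \<forall>t. w t \<in> carrier_vec q}"

text \<open>The identification of \<open>(k\<^sup>m)\<^sup>\<int> \<oplus> (k\<^sup>n)\<^sup>\<int>\<close> with \<open>(k\<^sup>m \<oplus> k\<^sup>n)\<^sup>\<int>\<close>.\<close>

definition traj_join :: "(int \<Rightarrow> 'k vec) \<Rightarrow> (int \<Rightarrow> 'k vec) \<Rightarrow> (int \<Rightarrow> 'k vec)" where
  "traj_join x y = (\<lambda>t. x t @\<^sub>v y t)"

definition linear_behaviour :: "nat \<Rightarrow> (int \<Rightarrow> 'k::field vec) set \<Rightarrow> bool" where
  "linear_behaviour q B \<longleftrightarrow> B \<subseteq> traj q \<and> (\<lambda>t. 0\<^sub>v q) \<in> B \<and>
     (\<forall>v \<in> B. \<forall>w \<in> B. (\<lambda>t. v t + w t) \<in> B) \<and>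
     (\<forall>c. \<forall>w \<in> B. (\<lambda>t. c \<cdot>\<^sub>v w t) \<in> B)"

definition time_invariant :: "(int \<Rightarrow> 'k vec) set \<Rightarrow> bool" where
  "time_invariant B \<longleftrightarrow> (\<forall>w \<in> B. \<forall>i. (\<lambda>t. w (t + i)) \<in> B)"

definition complete_behaviour :: "nat \<Rightarrow> (int \<Rightarrow> 'k vec) set \<Rightarrow> bool" where
  "complete_behaviour q B \<longleftrightarrow>
     (\<forall>w \<in> traj q.
        (\<forall>t0 t1. t0 \<le> t1 \<longrightarrow> restrict w {t0..t1} \<in> (\<lambda>v. restrict v {t0..t1}) ` B) \<longrightarrow> w \<in> B)"

type_synonym 'k behaviour = "((int \<Rightarrow> 'k vec) \<times> (int \<Rightarrow> 'k vec)) set"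

definition LTI_behaviours :: "nat \<Rightarrow> nat \<Rightarrow> 'k::field behaviour set" where
  "LTI_behaviours m n = {B. B \<subseteq> traj m \<times> traj n \<and>
     (let B' = (\<lambda>(x, y). traj_join x y) ` B in
       linear_behaviour (m + n) B' \<and> time_invariant B' \<and> complete_behaviour (m + n) B')}"

definition LTI :: "'k::field behaviour prop_data" where
  "LTI = \<lparr>
     Hom = LTI_behaviours,
     Cmp = (\<lambda>S R. R O S),
     Idn = (\<lambda>n. {(x, x) | x. x \<in> traj n}),
     Tns = (\<lambda>R S. {(traj_join x x', traj_join y y') | x x' y y'. (x, y) \<in> R \<and> (x', y') \<in> S}),
     Sym = (\<lambda>m n. {(traj_join x y, traj_join y x) | x y. x \<in> traj m \<and> y \<in> traj n}) \<rparr>"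


section \<open>The action of Laurent polynomials on trajectories\<close>

definition laurent_act :: "'k::field laurent \<Rightarrow> (int \<Rightarrow> 'k) \<Rightarrow> (int \<Rightarrow> 'k)" where
  "laurent_act p w = (\<lambda>t. \<Sum>i \<in> Poly_Mapping.keys p. Poly_Mapping.lookup p i * w (t - i))"

lemma laurent_act_s: "laurent_act (Poly_Mapping.single 1 1) w = (\<lambda>t. w (t - 1))"
  by (simp add: laurent_act_def)

lemma laurent_act_s_inverse: "laurent_act (Poly_Mapping.single (- 1) 1) w = (\<lambda>t. w (t + 1))"
  by (simp add: laurent_act_def)

definition theta :: "'k::field laurent mat \<Rightarrow> (int \<Rightarrow> 'k vec) \<Rightarrow> (int \<Rightarrow> 'k vec)" where
  "theta A x = (\<lambda>t. vec (dim_row A)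
     (\<lambda>i. \<Sum>j < dim_col A. laurent_act (A $$ (i, j)) (\<lambda>u. x u $ j) t))"

definition ker_theta :: "'k::field laurent mat \<Rightarrow> (int \<Rightarrow> 'k vec) set" where
  "ker_theta A = {w \<in> traj (dim_col A). theta A w = (\<lambda>t. 0\<^sub>v (dim_row A))}"

end

theory Submission
  imports Defs "HOL-Library.Function_Algebras"
begin

text \<open>
  The space \<open>(k\<^sup>q)\<^sup>\<int>\<close> is the full linear dual of the space of Laurent rows of length \<open>q\<close>, and \<open>ker \<theta>M\<close>
  is the annihilator of the row space of \<open>M\<close>. Extending linear functionals therefore gives both
  that \<open>ker \<theta>M \<subseteq> ker \<theta>N\<close> forces \<open>N = X M\<close>, and that the image of \<open>\<theta>M\<close> is cut out by the left
  syzygies of \<open>M\<close>. Completeness says that a behaviour is the annihilator of its own annihilator.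
  Since the Laurent ring is a PID, every module of rows has a basis, that is, it is the row space
  of an epi. So LTI behaviours correspond to submodules of row space, and these to jointly epic
  cospans up to isomorphism. A pushout of a span is a basis of the left syzygies of the stacked
  legs, which turns composition of corelations into composition of relations. The prop axioms for
  corelations are transported from those for relations.
\<close>

section \<open>Laurent polynomials\<close>

text \<open>A Laurent row has finite support while a trajectory is arbitrary, so prescribing a
  linear functional on monomial rows is the same as prescribing a trajectory, with no continuity
  condition. Functionals are only \<open>k\<close>-linear: the extension arguments take place over
  the field, in infinite-dimensional spaces, and the Laurent module structure enters through time
  invariance. The obstacle is composition. For corelations it is a pushout followed by the removal
  of a split mono, and the prop axioms are awkward to check for such composites. For relations the
  axioms are elementary, but closure under composition is not, since an intermediate trajectory must
  be found for all times at once. Each side supplies what the other lacks. The sign in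
  \<open>[A -B]\<close> makes equality of two images a kernel condition, so a kernel matrix splits
  into the legs of a cospan up to sign.\<close>

lemma poly_mapping_sum_induct [case_names single sum]:
  assumes single: "\<And>k v. P (Poly_Mapping.single k v)"
    and sum: "\<And>f g. P f \<Longrightarrow> P g \<Longrightarrow> P (f + g)"
  shows "P (p :: 'a \<Rightarrow>\<^sub>0 'b::monoid_add)"
proof (induction p rule: update_induct)
  case const
  then show ?case using single[of _ 0] by (simp only: single_zero)
next
  case (update p k v)
  then have "Poly_Mapping.update k v p = p + Poly_Mapping.single k v"
    by (intro poly_mapping_eqI) (auto simp: lookup_update lookup_add lookup_single in_keys_iff)
  then show ?case using update sum single by metis
qed

lemma laurent_act_superset:
  assumes "finite S" "Poly_Mapping.keys p \<subseteq> S"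
  shows "laurent_act p w t = (\<Sum>i\<in>S. Poly_Mapping.lookup p i * w (t - i))"
  unfolding laurent_act_def using assms
  by (intro sum.mono_neutral_left) (auto simp: in_keys_iff)

lemma laurent_act_add: "laurent_act (p + q) w t = laurent_act p w t + laurent_act q w t"
proof -
  let ?S = "Poly_Mapping.keys p \<union> Poly_Mapping.keys q"
  have "Poly_Mapping.keys (p + q) \<subseteq> ?S" by (rule Poly_Mapping.keys_add)
  then show ?thesis
    by (simp add: laurent_act_superset[of ?S] lookup_add distrib_right sum.distrib)
qed

lemma laurent_act_0 [simp]: "laurent_act 0 w t = 0"
  by (simp add: laurent_act_def)

lemma laurent_act_single: "laurent_act (Poly_Mapping.single i c) w t = c * w (t - i)"
  by (subst laurent_act_superset[of "{i}"]) auto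

lemma laurent_act_1 [simp]: "laurent_act 1 w = w"
  by (rule ext) (simp only: single_one[symmetric] laurent_act_single, simp)

lemma laurent_act_sum: "laurent_act (sum f A) w t = (\<Sum>a\<in>A. laurent_act (f a) w t)"
  by (induction A rule: infinite_finite_induct) (auto simp: laurent_act_add)

lemma laurent_act_uminus: "laurent_act (- p) w t = - laurent_act p w t"
  using laurent_act_add[of p "- p" w t] by (simp add: eq_neg_iff_add_eq_0 add.commute)

lemma laurent_act_traj_add:
  "laurent_act p (\<lambda>u. v u + w u) t = laurent_act p v t + laurent_act p w t"
  by (simp add: laurent_act_def algebra_simps sum.distrib)

lemma laurent_act_traj_scale: "laurent_act p (\<lambda>u. c * w u) t = c * laurent_act p w t"
  by (simp add: laurent_act_def algebra_simps sum_distrib_left)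

lemma laurent_act_traj_0 [simp]: "laurent_act p (\<lambda>u. 0) t = 0"
  by (simp add: laurent_act_def)

lemma laurent_act_traj_sum:
  "laurent_act p (\<lambda>u. \<Sum>a\<in>A. f a u) t = (\<Sum>a\<in>A. laurent_act p (f a) t)"
  by (induction A rule: infinite_finite_induct) (auto simp: laurent_act_traj_add)

lemma laurent_act_traj_shift: "laurent_act p (\<lambda>u. w (u + i)) t = laurent_act p w (t + i)"
  by (simp add: laurent_act_def algebra_simps)

text \<open>Both sides are additive in \<open>p\<close> and in \<open>q\<close>, so monomials
  suffice; there a shift by \<open>j\<close> followed by a shift by \<open>i\<close> is a shift by
  \<open>i + j\<close>. This module law is what makes \<open>theta\<close> functorial.\<close>

lemma laurent_act_mult: "laurent_act (p * q) w t = laurent_act p (laurent_act q w) t"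
proof (induction p arbitrary: t rule: poly_mapping_sum_induct)
  case (single i a)
  show ?case
  proof (induction q arbitrary: t rule: poly_mapping_sum_induct)
    case (single j b)
    then show ?case by (simp add: mult_single laurent_act_single algebra_simps)
  next
    case (sum f g)
    then show ?case by (simp add: distrib_left laurent_act_add laurent_act_traj_add[abs_def]
          laurent_act_single)
  qed
next
  case (sum f g)
  then show ?case by (simp add: distrib_right laurent_act_add)
qed

section \<open>Euclidean division of Laurent polynomials and bases of submodules\<close>

lemma lookup_single_mult:
  fixes p :: "'k::field laurent"
  shows "Poly_Mapping.lookup (Poly_Mapping.single i c * p) j = c * Poly_Mapping.lookup p (j - i)"
proof (induction p rule: poly_mapping_sum_induct)
  case (single k v)
  then show ?case by (auto simp: mult_single lookup_single when_def)
next
  case (sum f g)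
  then show ?case by (simp add: distrib_left lookup_add)
qed

text \<open>The Euclidean size: the distance between extreme exponents, unlike the degree, is
  unchanged by the units \<open>c s^i\<close>. At 0 the extremes are unspecified, so 0 is always
  treated apart.\<close>

definition width :: "'k::field laurent \<Rightarrow> nat" where
  "width p = nat (Max (Poly_Mapping.keys p) - Min (Poly_Mapping.keys p))"

text \<open>Two integers of the half-open interval differ by at most \<open>b - a - 1\<close>,
  whence the strict inequality.\<close>

lemma width_less:
  assumes "q \<noteq> 0" "Poly_Mapping.keys q \<subseteq> {a..<b}" "b - a \<le> int n"
  shows "width q < n"
proof -
  have "Poly_Mapping.keys q \<noteq> {}" using assms(1) by simp
  then have "Max (Poly_Mapping.keys q) \<in> {a..<b}" "Min (Poly_Mapping.keys q) \<in> {a..<b}"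
    using subsetD[OF assms(2) Max_in] subsetD[OF assms(2) Min_in] by simp_all
  then show ?thesis using assms(3) by (auto simp: width_def)
qed

text \<open>Division: a multiple of \<open>g\<close> cancels the top coefficient of \<open>p\<close> without lowering its order.\<close>

lemma laurent_division_step:
  fixes g p :: "'k::field laurent"
  assumes "g \<noteq> 0" "p \<noteq> 0" "width g \<le> width p"
  shows "\<exists>h. p - h * g = 0 \<or> width (p - h * g) < width p"
proof -
  define a where "a = Max (Poly_Mapping.keys p)"
  define b where "b = Max (Poly_Mapping.keys g)"
  define a' where "a' = Min (Poly_Mapping.keys p)"
  define b' where "b' = Min (Poly_Mapping.keys g)"
  have ne: "Poly_Mapping.keys p \<noteq> {}" "Poly_Mapping.keys g \<noteq> {}" using assms by auto
  have pk: "Poly_Mapping.lookup p k = 0" if "k < a' \<or> k > a" for k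
    using that Max_ge[of "Poly_Mapping.keys p" k] Min_le[of "Poly_Mapping.keys p" k]
    unfolding a_def a'_def by (metis finite_keys in_keys_iff linorder_not_le)
  have gk: "Poly_Mapping.lookup g k = 0" if "k < b' \<or> k > b" for k
    using that Max_ge[of "Poly_Mapping.keys g" k] Min_le[of "Poly_Mapping.keys g" k]
    unfolding b_def b'_def by (metis finite_keys in_keys_iff linorder_not_le)
  have gb: "Poly_Mapping.lookup g b \<noteq> 0"
    using Max_in[of "Poly_Mapping.keys g"] ne by (simp add: b_def in_keys_iff)
  have le: "a' \<le> a" "b' \<le> b" using ne by (auto simp: a_def a'_def b_def b'_def)
  then have wd: "b - b' \<le> a - a'" "int (width p) = a - a'"
    using assms(3) by (auto simp: width_def a_def a'_def b_def b'_def)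
  \<comment> \<open>Shifting \<open>g\<close> by \<open>a - b\<close> puts its top exponent
    \<open>b\<close> on \<open>a\<close>. Its lowest exponent lands on \<open>b' + a - b\<close>,
    which is at least \<open>a'\<close> exactly because \<open>g\<close> is no wider than
    \<open>p\<close>.\<close>
  define h where "h = Poly_Mapping.single (a - b) (Poly_Mapping.lookup p a / Poly_Mapping.lookup g b)"
  have lk: "Poly_Mapping.lookup (p - h * g) k =
      Poly_Mapping.lookup p k -
        Poly_Mapping.lookup p a / Poly_Mapping.lookup g b * Poly_Mapping.lookup g (k - (a - b))" for k
    by (simp add: h_def lookup_minus lookup_single_mult)
  have "Poly_Mapping.keys (p - h * g) \<subseteq> {a'..<a}"
  proof
    fix k assume "k \<in> Poly_Mapping.keys (p - h * g)"
    then have nz: "Poly_Mapping.lookup (p - h * g) k \<noteq> 0" by (simp add: in_keys_iff)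
    have "k \<noteq> a" using nz gb by (auto simp: lk)
    moreover have "\<not> k < a'" "\<not> k > a"
      using nz pk[of k] gk[of "k - (a - b)"] wd by (auto simp: lk)
    ultimately show "k \<in> {a'..<a}" by auto
  qed
  then show ?thesis using width_less[of "p - h * g" a' a "width p"] wd by auto
qed

text \<open>A nonzero element \<open>g\<close> of least width generates. Subtracting multiples of
  \<open>g\<close> stays in the ideal, so by minimality the division step remains applicable until
  the remainder is 0, and the falling width forces this to happen.\<close>

lemma laurent_ideal_principal:
  fixes I :: "'k::field laurent set"
  assumes zero: "0 \<in> I"
    and add: "\<And>p q. p \<in> I \<Longrightarrow> q \<in> I \<Longrightarrow> p + q \<in> I"
    and mult: "\<And>c p. p \<in> I \<Longrightarrow> c * p \<in> I"
  shows "\<exists>g\<in>I. \<forall>p\<in>I. g dvd p"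
proof (cases "I = {0}")
  case True
  then show ?thesis by auto
next
  case False
  then obtain p0 where "p0 \<in> I" "p0 \<noteq> 0" using zero by blast
  define g where "g = arg_min width (\<lambda>p. p \<in> I \<and> p \<noteq> 0)"
  have g: "g \<in> I" "g \<noteq> 0"
    using arg_min_natI[of "\<lambda>p. p \<in> I \<and> p \<noteq> 0" p0 width] \<open>p0 \<in> I\<close> \<open>p0 \<noteq> 0\<close>
    by (simp_all add: g_def)
  have min: "width g \<le> width p" if "p \<in> I" "p \<noteq> 0" for p
    unfolding g_def using that by (intro arg_min_nat_le) simp
  have "g dvd p" if "p \<in> I" for p
    using that
  proof (induction "width p" arbitrary: p rule: less_induct)
    case less
    show ?case
    proof (cases "p = 0")
      case False
      then obtain h where h: "p - h * g = 0 \<or> width (p - h * g) < width p"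
        using laurent_division_step g(2) min less.prems by blast
      have "p - h * g \<in> I" using add[OF less.prems mult[OF g(1), of "- h"]] by simp
      then have "g dvd p - h * g" using h less.hyps by auto
      then show ?thesis by (metis dvd_add dvd_triv_right diff_add_cancel)
    qed simp
  qed
  then show ?thesis using g(1) by blast
qed

text \<open>Induction on the number of coordinates. The entries at the last coordinate form a
  principal ideal, and a vector \<open>b\<close> attaining its generator completes a basis of the
  vectors vanishing there; if the generator is 0, nothing is added. Rows are functions vanishing
  from \<open>q\<close> on, so that the induction changes no type and sums are pointwise.\<close>

lemma submodule_basis:
  fixes N :: "(nat \<Rightarrow> 'k::field laurent) set"
  assumes "\<And>v j. v \<in> N \<Longrightarrow> q \<le> j \<Longrightarrow> v j = 0"
    and "0 \<in> N"
    and "\<And>u v. u \<in> N \<Longrightarrow> v \<in> N \<Longrightarrow> u + v \<in> N"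
    and "\<And>c v. v \<in> N \<Longrightarrow> (\<lambda>j. c * v j) \<in> N"
  shows "\<exists>(d::nat) e. (\<forall>i<d. e i \<in> N) \<and> (\<forall>v\<in>N. \<exists>c. \<forall>j. v j = (\<Sum>i<d. c i * e i j)) \<and>
    (\<forall>c. (\<forall>j. (\<Sum>i<d. c i * e i j) = 0) \<longrightarrow> (\<forall>i<d. c i = 0))"
  using assms
proof (induction q arbitrary: N)
  case 0
  then have "\<forall>v\<in>N. \<forall>j. v j = 0" by auto
  then show ?case by (intro exI[of _ 0]) auto
next
  case (Suc q)
  define N' where "N' = {v \<in> N. v q = 0}"
  have "\<exists>(d::nat) e. (\<forall>i<d. e i \<in> N') \<and> (\<forall>v\<in>N'. \<exists>c. \<forall>j. v j = (\<Sum>i<d. c i * e i j)) \<and>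
    (\<forall>c. (\<forall>j. (\<Sum>i<d. c i * e i j) = 0) \<longrightarrow> (\<forall>i<d. c i = 0))"
  proof (rule Suc.IH)
    fix v j assume "v \<in> N'" "q \<le> j"
    then show "v j = 0" using Suc.prems(1)[of v j] by (cases "j = q") (auto simp: N'_def)
  qed (use Suc.prems in \<open>auto simp: N'_def\<close>)
  then obtain d :: nat and e where de: "(\<forall>i<d. e i \<in> N') \<and>
      (\<forall>v\<in>N'. \<exists>c. \<forall>j. v j = (\<Sum>i<d. c i * e i j)) \<and>
      (\<forall>c. (\<forall>j. (\<Sum>i<d. c i * e i j) = 0) \<longrightarrow> (\<forall>i<d. c i = 0))"
    by (elim exE)
  have e: "\<And>i. i < d \<Longrightarrow> e i \<in> N'"
    and span: "\<And>v. v \<in> N' \<Longrightarrow> \<exists>c. \<forall>j. v j = (\<Sum>i<d. c i * e i j)"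
    and ind: "\<And>c i. (\<And>j. (\<Sum>i<d. c i * e i j) = 0) \<Longrightarrow> i < d \<Longrightarrow> c i = 0"
    using de by simp_all
  have "\<exists>g\<in>(\<lambda>v. v q) ` N. \<forall>p\<in>(\<lambda>v. v q) ` N. g dvd p"
  proof (rule laurent_ideal_principal)
    show "0 \<in> (\<lambda>v. v q) ` N" using Suc.prems(2) by force
  next
    fix p p' assume "p \<in> (\<lambda>v. v q) ` N" "p' \<in> (\<lambda>v. v q) ` N"
    then show "p + p' \<in> (\<lambda>v. v q) ` N" using Suc.prems(3) by (force simp: image_iff)
  next
    fix c p assume "p \<in> (\<lambda>v. v q) ` N"
    then show "c * p \<in> (\<lambda>v. v q) ` N" using Suc.prems(4) by (force simp: image_iff)
  qed
  then obtain b where b: "b \<in> N" and dvd: "\<And>v. v \<in> N \<Longrightarrow> b q dvd v q" by auto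
  show ?case
  proof (cases "b q = 0")
    case True
    then have "N' = N" using dvd by (auto simp: N'_def)
    then show ?thesis using e span ind by (intro exI[of _ d] exI[of _ e]) auto
  next
    case False
    let ?e = "e(d := b)"
    have sum_e: "(\<Sum>i<Suc d. c i * ?e i j) = (\<Sum>i<d. c i * e i j) + c d * b j" for c j
      by simp
    have span': "\<exists>c. \<forall>j. v j = (\<Sum>i<Suc d. c i * ?e i j)" if v: "v \<in> N" for v
    proof -
      obtain a where a: "v q = b q * a" using dvd[OF v] by blast
      have "v + (\<lambda>j. (- a) * b j) \<in> N"
        by (rule Suc.prems(3)[OF v Suc.prems(4)[OF b]])
      then have "v + (\<lambda>j. (- a) * b j) \<in> N'"
        using a by (simp add: N'_def mult.commute)
      then obtain c where c: "\<And>j. v j - a * b j = (\<Sum>i<d. c i * e i j)"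
        using span by fastforce
      have "v j = (\<Sum>i<Suc d. (c(d := a)) i * ?e i j)" for j
        unfolding sum_e using c[of j] by (simp add: algebra_simps)
      then show ?thesis by blast
    qed
    have ind': "c i = 0" if z: "\<And>j. (\<Sum>i<Suc d. c i * ?e i j) = 0" and "i < Suc d" for c i
    proof -
      \<comment> \<open>Among the basis vectors only \<open>b\<close> is nonzero at coordinate
        \<open>q\<close>, so in a ring without zero divisors its coefficient \<open>c d\<close>
        vanishes.\<close>
      have "(\<Sum>i<d. c i * e i q) = 0" using e by (auto simp: N'_def)
      then have cd: "c d = 0" using z[of q] False unfolding sum_e by simp
      then have "(\<Sum>i<d. c i * e i j) = 0" for j using z[of j] unfolding sum_e by simp
      then show ?thesis using ind cd \<open>i < Suc d\<close> by (cases "i = d") auto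
    qed
    show ?thesis
    proof (intro exI conjI)
      show "\<forall>i<Suc d. ?e i \<in> N" using e b by (auto simp: N'_def less_Suc_eq)
      show "\<forall>v\<in>N. \<exists>c. \<forall>j. v j = (\<Sum>i<Suc d. c i * ?e i j)"
        by (intro ballI) (rule span')
      show "\<forall>c. (\<forall>j. (\<Sum>i<Suc d. c i * ?e i j) = 0) \<longrightarrow> (\<forall>i<Suc d. c i = 0)"
        by (intro allI impI) (rule ind', rule spec)
    qed
  qed
qed

section \<open>Matrices acting on trajectories\<close>

lemma sum_lessThan_add:
  fixes f :: "nat \<Rightarrow> 'a::comm_monoid_add"
  shows "(\<Sum>j<m + n. f j) = (\<Sum>j<m. f j) + (\<Sum>j<n. f (m + j))"
  by (induction n) (simp_all add: add.assoc)

lemma trajD: "w \<in> traj q \<Longrightarrow> dim_vec (w t) = q"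
  by (auto simp: traj_def)

lemma traj_eqI:
  assumes "x \<in> traj q" "y \<in> traj q" "\<And>t j. j < q \<Longrightarrow> x t $ j = y t $ j"
  shows "x = y"
  using assms by (intro ext eq_vecI) (auto simp: trajD)

lemma dim_theta [simp]: "dim_vec (theta A x t) = dim_row A"
  by (simp add: theta_def)

lemma theta_index:
  "i < dim_row A \<Longrightarrow>
    theta A x t $ i = (\<Sum>j<dim_col A. laurent_act (A $$ (i, j)) (\<lambda>u. x u $ j) t)"
  by (simp add: theta_def)

lemma theta_in_traj: "A \<in> carrier_mat n m \<Longrightarrow> theta A x \<in> traj n"
  by (auto simp: traj_def intro!: carrier_vecI)

lemma traj_join_in_traj: "x \<in> traj m \<Longrightarrow> y \<in> traj n \<Longrightarrow> traj_join x y \<in> traj (m + n)"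
  by (auto simp: traj_def traj_join_def)

lemma traj_join_inject:
  assumes "x \<in> traj m" "x' \<in> traj m"
  shows "traj_join x y = traj_join x' y' \<longleftrightarrow> x = x' \<and> y = y'"
proof
  assume eq: "traj_join x y = traj_join x' y'"
  have "x t = x' t \<and> y t = y' t" for t
    using fun_cong[OF eq, of t] assms append_vec_eq[of "x t" m "x' t" "y t" "y' t"]
    by (auto simp: traj_def traj_join_def)
  then show "x = x' \<and> y = y'" by blast
qed simp

lemma traj_splitE:
  assumes "w \<in> traj (m + n)"
  obtains x y where "x \<in> traj m" "y \<in> traj n" "w = traj_join x y"
proof
  show "(\<lambda>t. vec_first (w t) m) \<in> traj m" "(\<lambda>t. vec_last (w t) n) \<in> traj n"
    by (auto simp: traj_def)
  show "w = traj_join (\<lambda>t. vec_first (w t) m) (\<lambda>t. vec_last (w t) n)"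
    using assms by (auto simp: traj_def traj_join_def)
qed

lemma theta_mult:
  assumes B: "B \<in> carrier_mat l n" and A: "A \<in> carrier_mat n m"
  shows "theta (B * A) x = theta B (theta A x)"
proof (rule traj_eqI)
  show "theta (B * A) x \<in> traj l" "theta B (theta A x) \<in> traj l"
    using assms by (auto intro!: theta_in_traj)
  fix t i assume i: "i < l"
  have "theta (B * A) x t $ i =
      (\<Sum>j<m. \<Sum>k<n. laurent_act (B $$ (i, k)) (laurent_act (A $$ (k, j)) (\<lambda>u. x u $ j)) t)"
    using assms i
    by (simp add: theta_index scalar_prod_def laurent_act_sum laurent_act_mult atLeast0LessThan)
  also have "\<dots> = (\<Sum>k<n. laurent_act (B $$ (i, k))
      (\<lambda>u. \<Sum>j<m. laurent_act (A $$ (k, j)) (\<lambda>u. x u $ j) u) t)"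
    unfolding laurent_act_traj_sum by (rule sum.swap)
  also have "\<dots> = theta B (theta A x) t $ i"
    using assms i by (simp add: theta_index)
  finally show "theta (B * A) x t $ i = theta B (theta A x) t $ i" .
qed

lemma theta_one:
  assumes "x \<in> traj n"
  shows "theta (1\<^sub>m n) x = x"
proof (rule traj_eqI)
  fix t i assume i: "i < n"
  have "theta (1\<^sub>m n) x t $ i = (\<Sum>j<n. if i = j then x t $ j else 0)"
    unfolding theta_index[of i "1\<^sub>m n", simplified, OF i] using i
    by (intro sum.cong) auto
  then show "theta (1\<^sub>m n) x t $ i = x t $ i" using i by simp
qed (use assms theta_in_traj[of "1\<^sub>m n" n n] in auto)

lemma theta_uminus:
  assumes "A \<in> carrier_mat n m"
  shows "theta (- A) x = (\<lambda>t. - theta A x t)"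
  by (rule ext, rule eq_vecI) (use assms in \<open>auto simp: theta_index laurent_act_uminus sum_negf\<close>)

lemma theta_copair:
  assumes A: "A \<in> carrier_mat d m" and B: "B \<in> carrier_mat d n"
    and x: "x \<in> traj m" and y: "y \<in> traj n"
  shows "theta (copair A B) (traj_join x y) = (\<lambda>t. theta A x t + theta B y t)"
proof (rule ext, rule eq_vecI)
  fix t i assume "i < dim_vec (theta A x t + theta B y t)"
  then have i: "i < d" using assms by simp
  then show "theta (copair A B) (traj_join x y) t $ i = (theta A x t + theta B y t) $ i"
    using assms
    by (simp add: theta_index copair_def traj_join_def sum_lessThan_add trajD[OF x] trajD[OF y])
qed (use assms in \<open>simp add: copair_def\<close>)

lemma copair_carrier [intro, simp]:
  "A \<in> carrier_mat d m \<Longrightarrow> B \<in> carrier_mat d n \<Longrightarrow> copair A B \<in> carrier_mat d (m + n)"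
  by (auto simp: copair_def)

text \<open>The value of the isomorphism on a representing cospan. Reading \<open>m\<close> and
  \<open>n\<close> off the matrices allows it to be applied to every member of a class
  uniformly.\<close>

definition behaviour_of :: "'k::field laurent mat \<Rightarrow> 'k laurent mat \<Rightarrow> 'k behaviour" where
  "behaviour_of A B = {(x, y) \<in> traj (dim_col A) \<times> traj (dim_col B). theta A x = theta B y}"

lemma in_behaviour_of:
  assumes "A \<in> carrier_mat d m" "B \<in> carrier_mat d n" "x \<in> traj m" "y \<in> traj n"
  shows "traj_join x y \<in> ker_theta (copair A (- B)) \<longleftrightarrow> (x, y) \<in> behaviour_of A B"
proof -
  have "theta A x t + - theta B y t = 0\<^sub>v d \<longleftrightarrow> theta A x t = theta B y t" for t
    using assms by (auto simp: vec_eq_iff)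
  moreover have "theta (copair A (- B)) (traj_join x y) = (\<lambda>t. theta A x t + - theta B y t)"
    using assms by (subst theta_copair[of _ d m _ n]) (auto simp: theta_uminus)
  moreover have "traj_join x y \<in> traj (m + n)" using assms by (intro traj_join_in_traj)
  moreover have "dim_col (copair A (- B)) = m + n" "dim_row (copair A (- B)) = d"
    using assms by (auto simp: copair_def)
  ultimately show ?thesis using assms by (simp add: ker_theta_def behaviour_of_def fun_eq_iff)
qed

lemma traj_join_behaviour_of:
  assumes "A \<in> carrier_mat d m" "B \<in> carrier_mat d n"
  shows "(\<lambda>(x, y). traj_join x y) ` behaviour_of A B = ker_theta (copair A (- B))"
proof
  show "(\<lambda>(x, y). traj_join x y) ` behaviour_of A B \<subseteq> ker_theta (copair A (- B))"
    using in_behaviour_of[OF assms] assms by (auto simp: behaviour_of_def)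
  show "ker_theta (copair A (- B)) \<subseteq> (\<lambda>(x, y). traj_join x y) ` behaviour_of A B"
  proof
    fix w assume w: "w \<in> ker_theta (copair A (- B))"
    then have "w \<in> traj (m + n)" using assms by (auto simp: ker_theta_def copair_def)
    then obtain x y where "x \<in> traj m" "y \<in> traj n" "w = traj_join x y" by (rule traj_splitE)
    then show "w \<in> (\<lambda>(x, y). traj_join x y) ` behaviour_of A B"
      using w in_behaviour_of[OF assms, of x y] by auto
  qed
qed

section \<open>Trajectories as linear functionals on Laurent rows\<close>

text \<open>Rows form a Laurent module, but functionals are extended over the field; its scalars act
  as constant Laurent polynomials. With rows as functions on \<open>nat\<close>, rows of all lengths
  share one vector space.\<close>

definition vscale :: "'k::field \<Rightarrow> (nat \<Rightarrow> 'k laurent) \<Rightarrow> (nat \<Rightarrow> 'k laurent)" where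
  "vscale c v = (\<lambda>j. Poly_Mapping.single 0 c * v j)"

text \<open>The product of the row \<open>c\<close> with \<open>M\<close>. Entries of
  \<open>c\<close> beyond the rows of \<open>M\<close> are ignored and the result is padded with 0,
  so this is a linear map on the whole space whose range is the row space.\<close>

definition row_comb :: "'k::field laurent mat \<Rightarrow> (nat \<Rightarrow> 'k laurent) \<Rightarrow> (nat \<Rightarrow> 'k laurent)" where
  "row_comb M c = (\<lambda>j. if j < dim_col M then \<Sum>i<dim_row M. c i * M $$ (i, j) else 0)"

definition row_fun :: "'k::field laurent mat \<Rightarrow> nat \<Rightarrow> (nat \<Rightarrow> 'k laurent)" where
  "row_fun M i = (\<lambda>j. if j < dim_col M then M $$ (i, j) else 0)"

text \<open>Evaluation at time 0 alone loses nothing, since multiplying the row by a monomial moves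
  any other time to 0.\<close>

definition pairing :: "nat \<Rightarrow> (int \<Rightarrow> 'k::field vec) \<Rightarrow> (nat \<Rightarrow> 'k laurent) \<Rightarrow> 'k" where
  "pairing q w v = (\<Sum>j<q. laurent_act (v j) (\<lambda>u. w u $ j) 0)"

interpretation V: vector_space "vscale :: 'k::field \<Rightarrow> _"
proof
  show "vscale a (vscale b v) = vscale (a * b) v" for a b :: 'k and v
    by (simp add: vscale_def mult_single flip: mult.assoc)
qed (simp_all add: vscale_def fun_eq_iff distrib_left distrib_right single_add)

interpretation K: vector_space "(*) :: 'k::field \<Rightarrow> _"
  by standard (simp_all add: algebra_simps)

interpretation VV: vector_space_pair vscale vscale
  by standard

interpretation VK: vector_space_pair vscale "(*) :: 'k::field \<Rightarrow> _"
  by standard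

lemma laurent_act_scale:
  "laurent_act (Poly_Mapping.single 0 c * p) w t = c * laurent_act p w t"
  by (simp add: laurent_act_mult laurent_act_single)

lemma linear_pairing: "Vector_Spaces.linear vscale (*) (pairing q w)"
  unfolding Vector_Spaces.linear_iff
proof (intro conjI allI)
  show "pairing q w (u + v) = pairing q w u + pairing q w v" for u v
    by (simp add: pairing_def laurent_act_add sum.distrib)
  show "pairing q w (vscale c v) = c * pairing q w v" for c v
    by (simp add: pairing_def vscale_def laurent_act_scale sum_distrib_left)
qed (rule V.vector_space_axioms K.vector_space_axioms)+

lemma linear_row_comb: "Vector_Spaces.linear vscale vscale (row_comb M)"
  unfolding Vector_Spaces.linear_iff
proof (intro conjI allI)
  show "row_comb M (u + v) = row_comb M u + row_comb M v" for u v
    by (rule ext) (simp add: row_comb_def distrib_right sum.distrib)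
  show "row_comb M (vscale c v) = vscale c (row_comb M v)" for c v
    by (rule ext) (simp add: row_comb_def vscale_def sum_distrib_left mult.assoc)
qed (rule V.vector_space_axioms)+

text \<open>Under the pairing, \<open>theta M\<close> is the transpose of \<open>row_comb M\<close>.
  Questions about kernels and images on trajectories thereby become questions about row
  spaces.\<close>

lemma pairing_row_comb:
  assumes "M \<in> carrier_mat n m"
  shows "pairing m w (row_comb M c) = pairing n (theta M w) c"
proof -
  have "pairing m w (row_comb M c) =
      (\<Sum>j<m. \<Sum>i<n. laurent_act (c i) (laurent_act (M $$ (i, j)) (\<lambda>u. w u $ j)) 0)"
    using assms by (simp add: pairing_def row_comb_def laurent_act_sum laurent_act_mult)
  also have "\<dots> = (\<Sum>i<n. laurent_act (c i)
      (\<lambda>u. \<Sum>j<m. laurent_act (M $$ (i, j)) (\<lambda>u. w u $ j) u) 0)"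
    unfolding laurent_act_traj_sum by (rule sum.swap)
  also have "\<dots> = pairing n (theta M w) c"
    using assms by (simp add: pairing_def theta_index)
  finally show ?thesis .
qed

definition unit_row :: "nat \<Rightarrow> 'k::field laurent \<Rightarrow> (nat \<Rightarrow> 'k laurent)" where
  "unit_row j p = (\<lambda>j'. if j' = j then p else 0)"

lemma pairing_unit_row:
  assumes "j < q"
  shows "pairing q w (unit_row j p) = laurent_act p (\<lambda>u. w u $ j) 0"
proof -
  have "pairing q w (unit_row j p) =
      (\<Sum>j'<q. if j' = j then laurent_act p (\<lambda>u. w u $ j') 0 else 0)"
    unfolding pairing_def unit_row_def by (intro sum.cong) auto
  then show ?thesis using assms by simp
qed

lemma traj_eq_pairingI:
  assumes "x \<in> traj q" "y \<in> traj q" "\<And>c. pairing q x c = pairing q y c"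
  shows "x = y"
proof (rule traj_eqI[OF assms(1,2)])
  fix t j assume "j < q"
  \<comment> \<open>Acting by \<open>s^i\<close> and evaluating at 0 reads the value at time
    \<open>- i\<close>; the exponent \<open>- t\<close> reads time \<open>t\<close>.\<close>
  then show "x t $ j = y t $ j"
    using assms(3)[of "unit_row j (Poly_Mapping.single (- t) 1)"]
    by (simp add: pairing_unit_row laurent_act_single)
qed

lemma ker_theta_pairing:
  assumes "M \<in> carrier_mat n m" "w \<in> traj m"
  shows "w \<in> ker_theta M \<longleftrightarrow> (\<forall>c. pairing m w (row_comb M c) = 0)"
proof -
  have z: "(\<lambda>t. 0\<^sub>v n) \<in> traj n" by (simp add: traj_def)
  have z': "pairing n (\<lambda>t. 0\<^sub>v n) c = 0" for c :: "nat \<Rightarrow> 'k::field laurent"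
    by (simp add: pairing_def)
  have "w \<in> ker_theta M \<longleftrightarrow> theta M w = (\<lambda>t. 0\<^sub>v n)"
    using assms by (auto simp: ker_theta_def)
  also have "\<dots> \<longleftrightarrow> (\<forall>c. pairing n (theta M w) c = 0)"
    using traj_eq_pairingI[OF theta_in_traj[OF assms(1)] z, of w] z' by metis
  finally show ?thesis using assms by (simp add: pairing_row_comb)
qed

text \<open>Rows with a single monomial entry form a \<open>k\<close>-basis of the rows supported
  below \<open>q\<close>. The values of the functional on them are unconstrained and, arranged by
  time and position, they are the trajectory itself.\<close>

lemma functional_is_pairing:
  fixes \<phi> :: "(nat \<Rightarrow> 'k::field laurent) \<Rightarrow> 'k"
  assumes "Vector_Spaces.linear vscale (*) \<phi>"
  shows "\<exists>w\<in>traj q. \<forall>v. (\<forall>j\<ge>q. v j = 0) \<longrightarrow> \<phi> v = pairing q w v"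
proof (intro bexI allI impI)
  interpret \<phi>: Vector_Spaces.linear vscale "(*)" \<phi> by fact
  let ?w = "\<lambda>t. vec q (\<lambda>j. \<phi> (unit_row j (Poly_Mapping.single (- t) 1)))"
  show "?w \<in> traj q" by (simp add: traj_def)
  have unit: "\<phi> (unit_row j p) = laurent_act p (\<lambda>u. ?w u $ j) 0" if "j < q" for j p
  proof (induction p rule: poly_mapping_sum_induct)
    case (single i a)
    have "unit_row j (Poly_Mapping.single i a) = vscale a (unit_row j (Poly_Mapping.single i 1))"
      by (auto simp: unit_row_def vscale_def mult_single)
    then show ?case using that by (simp add: \<phi>.scale laurent_act_single)
  next
    case (sum f g)
    have "unit_row j (f + g) = unit_row j f + unit_row j g" by (auto simp: unit_row_def)
    then have "\<phi> (unit_row j (f + g)) = \<phi> (unit_row j f) + \<phi> (unit_row j g)"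
      using \<phi>.add by metis
    then show ?case using sum by (simp add: laurent_act_add)
  qed
  fix v :: "nat \<Rightarrow> 'k laurent" assume v: "\<forall>j\<ge>q. v j = 0"
  have s: "(\<Sum>j\<in>A. unit_row j (v j)) i = (\<Sum>j\<in>A. unit_row j (v j) i)" for A i
    by (induction A rule: infinite_finite_induct) auto
  have "v = (\<Sum>j<q. unit_row j (v j))"
    by (rule ext) (auto simp: s, auto simp: unit_row_def v not_less)
  then have "\<phi> v = \<phi> (\<Sum>j<q. unit_row j (v j))" by simp
  also have "\<dots> = (\<Sum>j<q. \<phi> (unit_row j (v j)))" by (rule \<phi>.sum)
  also have "\<dots> = pairing q ?w v" unfolding pairing_def by (intro sum.cong refl unit) simp
  finally show "\<phi> v = pairing q ?w v" .
qed

text \<open>A basis of \<open>S\<close> stays independent when \<open>r\<close> is added, so the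
  assignment 0 on the basis and 1 on \<open>r\<close> extends linearly. Any field and any dimension
  will do.\<close>

lemma separating_functional:
  fixes S :: "(nat \<Rightarrow> 'k::field laurent) set"
  assumes S: "V.subspace S" and r: "r \<notin> S"
  shows "\<exists>\<phi>. Vector_Spaces.linear vscale (*) \<phi> \<and> (\<forall>v\<in>S. \<phi> v = 0) \<and> \<phi> r \<noteq> 0"
proof -
  obtain B where B: "B \<subseteq> S" "V.independent B" "S \<subseteq> V.span B"
    using V.maximal_independent_subset by blast
  have sub: "V.span B \<subseteq> S" using V.span_minimal[OF B(1) S] .
  then have "V.independent (insert r B)" using r B(2) by (intro V.independent_insertI) auto
  then obtain \<phi> :: "(nat \<Rightarrow> 'k laurent) \<Rightarrow> 'k" where lin: "Vector_Spaces.linear vscale (*) \<phi>"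
    and \<phi>: "\<forall>x\<in>insert r B. \<phi> x = (if x = r then 1 else 0)"
    using VK.linear_independent_extend[of "insert r B" "\<lambda>x. if x = r then 1 else 0"] by blast
  have "\<phi> x = 0" if "x \<in> B" for x using that \<phi> r B(1) by auto
  then have "\<phi> v = 0" if "v \<in> S" for v
    using VK.linear_eq_0_on_span[OF lin] that B(3) by blast
  moreover have "\<phi> r \<noteq> 0" using \<phi> by simp
  ultimately show ?thesis using lin by blast
qed

section \<open>Trajectories as an injective cogenerator: inclusion of kernels and
  solvability\<close>

lemma row_comb_row_fun:
  assumes "X \<in> carrier_mat p d" "E \<in> carrier_mat d q" "i < p"
  shows "row_comb E (row_fun X i) = row_fun (X * E) i"
  using assms by (auto simp: row_comb_def row_fun_def scalar_prod_def atLeast0LessThan)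

lemma row_comb_support: "M \<in> carrier_mat d q \<Longrightarrow> q \<le> j \<Longrightarrow> row_comb M c j = 0"
  by (auto simp: row_comb_def)

lemma factor_rows:
  assumes A: "A \<in> carrier_mat p q" and E: "E \<in> carrier_mat d q"
    and rows: "\<And>i. i < p \<Longrightarrow> row_fun A i \<in> range (row_comb E)"
  shows "\<exists>X \<in> carrier_mat p d. A = X * E"
proof -
  obtain c where c: "\<And>i. i < p \<Longrightarrow> row_fun A i = row_comb E (c i)"
    using rows unfolding image_iff by metis
  let ?X = "mat p d (\<lambda>(i, j). c i j)"
  have "A = ?X * E"
  proof (rule eq_matI)
    fix i j assume "i < dim_row (?X * E)" "j < dim_col (?X * E)"
    then have ij: "i < p" "j < q" using E by auto
    then show "A $$ (i, j) = (?X * E) $$ (i, j)"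
      using fun_cong[OF c[OF ij(1)], of j] A E
      by (simp add: row_fun_def row_comb_def scalar_prod_def atLeast0LessThan)
  qed (use A E in auto)
  then show ?thesis by (intro bexI[of _ ?X]) auto
qed

text \<open>This is the cogenerator property. A row of \<open>N\<close> outside the row space of
  \<open>M\<close> would be separated from it by a functional; the trajectory representing that
  functional is annihilated by \<open>M\<close> but not by \<open>N\<close>.\<close>

lemma ker_theta_subset_imp_factor:
  assumes M: "M \<in> carrier_mat d q" and N: "N \<in> carrier_mat e q"
    and sub: "ker_theta M \<subseteq> ker_theta N"
  shows "\<exists>X \<in> carrier_mat e d. N = X * M"
proof (rule factor_rows[OF N M])
  fix i assume i: "i < e"
  show "row_fun N i \<in> range (row_comb M)"
  proof (rule ccontr)
    assume nin: "row_fun N i \<notin> range (row_comb M)"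
    have sub': "V.subspace (range (row_comb M))"
      using VV.linear_subspace_image[OF linear_row_comb V.subspace_UNIV] .
    obtain \<phi> where \<phi>: "Vector_Spaces.linear vscale (*) \<phi>"
      "\<forall>v\<in>range (row_comb M). \<phi> v = 0" "\<phi> (row_fun N i) \<noteq> 0"
      using separating_functional[OF sub' nin] by (elim exE conjE)
    obtain w where w: "w \<in> traj q" and pw: "\<forall>v. (\<forall>j\<ge>q. v j = 0) \<longrightarrow> \<phi> v = pairing q w v"
      using functional_is_pairing[OF \<phi>(1), of q] by (elim bexE)
    have pw': "\<phi> (row_comb M c) = pairing q w (row_comb M c)" for c
      using pw[rule_format] row_comb_support[OF M] by blast
    have "w \<in> ker_theta M"
      unfolding ker_theta_pairing[OF M w]
      unfolding pw'[symmetric] using \<phi>(2) by blast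
    then have "\<forall>c. pairing q w (row_comb N c) = 0"
      using sub ker_theta_pairing[OF N w] by blast
    moreover have "row_fun N i = row_comb N (row_fun (1\<^sub>m e) i)"
      using N i by (simp add: row_comb_row_fun[of _ e e])
    ultimately have "pairing q w (row_fun N i) = 0" by simp
    moreover have "\<phi> (row_fun N i) = pairing q w (row_fun N i)"
      using N by (intro pw[rule_format]) (auto simp: row_fun_def)
    ultimately show False using \<phi>(3) by simp
  qed
qed

text \<open>This is the injectivity of the trajectory module, known as the fundamental principle.
  The solution must pair with \<open>row_comb M c\<close> as \<open>y\<close> pairs with
  \<open>c\<close>. This is consistent because two such \<open>c\<close> differ by a left syzygy of
  \<open>M\<close>, hence by a combination of rows of \<open>L\<close>, which \<open>y\<close>
  annihilates.\<close>

lemma theta_solvable: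
  assumes M: "M \<in> carrier_mat n m" and L: "L \<in> carrier_mat l n"
    and span: "\<And>r. r \<in> carrier_mat 1 n \<Longrightarrow> r * M = 0\<^sub>m 1 m \<Longrightarrow> \<exists>X \<in> carrier_mat 1 l. r = X * L"
    and y: "y \<in> ker_theta L"
  shows "\<exists>x \<in> traj m. theta M x = y"
proof -
  have ytraj: "y \<in> traj n" using y L by (auto simp: ker_theta_def)
  \<comment> \<open>\<open>g\<close> inverts \<open>row_comb M\<close> on its range and is extended
    to all rows over the field. For the 1 by 1 matrix \<open>s - 1\<close> no Laurent-linear
    extension exists.\<close>
  obtain g where g: "Vector_Spaces.linear vscale vscale g"
    and inv: "\<And>c. row_comb M (g (row_comb M c)) = row_comb M c"
    using VV.linear_exists_right_inverse_on[OF linear_row_comb[of M] V.subspace_UNIV] by blast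
  have lin: "Vector_Spaces.linear vscale (*) (pairing n y \<circ> g)"
    using Vector_Spaces.linear_compose[OF g linear_pairing] .
  obtain x where x: "x \<in> traj m"
    and px: "\<forall>v. (\<forall>j\<ge>m. v j = 0) \<longrightarrow> (pairing n y \<circ> g) v = pairing m x v"
    using functional_is_pairing[OF lin, of m] by (elim bexE)
  have px': "pairing n y (g (row_comb M c)) = pairing m x (row_comb M c)" for c
    using px[rule_format, of "row_comb M c"] row_comb_support[OF M] by simp
  have "pairing n (theta M x) c = pairing n y c" for c
  proof -
    interpret f: Vector_Spaces.linear vscale vscale "row_comb M" by (rule linear_row_comb)
    interpret p: Vector_Spaces.linear vscale "(*)" "pairing n y" by (rule linear_pairing)
    define v where "v = g (row_comb M c) - c"
    have v0: "row_comb M v = 0" unfolding v_def f.diff inv by simp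
    \<comment> \<open>\<open>v\<close> may have entries from position \<open>n\<close> on. Neither
      \<open>row_comb M\<close> nor the pairing of length \<open>n\<close> sees them, so they are
      cut off.\<close>
    define r where "r = mat 1 n (\<lambda>(i, j). v j)"
    have "r * M = 0\<^sub>m 1 m"
    proof (rule eq_matI)
      fix i j assume "i < dim_row (0\<^sub>m 1 m :: 'a laurent mat)" "j < dim_col (0\<^sub>m 1 m :: 'a laurent mat)"
      then show "(r * M) $$ (i, j) = 0\<^sub>m 1 m $$ (i, j)"
        using fun_cong[OF v0, of j] M
        by (simp add: r_def row_comb_def scalar_prod_def atLeast0LessThan)
    qed (use M in \<open>auto simp: r_def\<close>)
    then obtain X where X: "X \<in> carrier_mat 1 l" "r = X * L"
      using span[of r] by (auto simp: r_def)
    then have "row_fun r 0 = row_comb L (row_fun X 0)"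
      using row_comb_row_fun[OF X(1) L] by simp
    then have "pairing n y (row_fun r 0) = 0" using y ker_theta_pairing[OF L ytraj] by simp
    moreover have "pairing n y (row_fun r 0) = pairing n y v"
      by (simp add: pairing_def row_fun_def r_def)
    ultimately have "pairing n y (g (row_comb M c)) = pairing n y c"
      by (simp add: v_def p.diff)
    then show ?thesis
      using px' pairing_row_comb[OF M] by simp
  qed
  then have "theta M x = y" using traj_eq_pairingI[OF theta_in_traj[OF M] ytraj] by blast
  then show ?thesis using x by blast
qed

section \<open>Kernels are linear, time-invariant and complete\<close>

lemma linear_behaviour_ker_theta:
  assumes M: "M \<in> carrier_mat n q"
  shows "linear_behaviour q (ker_theta M)"
proof -
  have add: "pairing q (\<lambda>t. v t + w t) c = pairing q v c + pairing q w c"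
    if "v \<in> traj q" "w \<in> traj q" for v w c
    using trajD[OF that(1)] trajD[OF that(2)]
    by (simp add: pairing_def laurent_act_traj_add sum.distrib)
  have scale: "pairing q (\<lambda>t. a \<cdot>\<^sub>v w t) c = a * pairing q w c" if "w \<in> traj q" for a w c
    using trajD[OF that] by (simp add: pairing_def laurent_act_traj_scale sum_distrib_left)
  have zero: "pairing q (\<lambda>t. 0\<^sub>v q) c = 0" for c :: "nat \<Rightarrow> 'a laurent"
    by (simp add: pairing_def)
  have sub: "ker_theta M \<subseteq> traj q" using M by (auto simp: ker_theta_def)
  have clos: "(\<lambda>t. 0\<^sub>v q :: 'a vec) \<in> traj q"
    "\<And>v w. v \<in> traj q \<Longrightarrow> w \<in> traj q \<Longrightarrow> (\<lambda>t. v t + w t :: 'a vec) \<in> traj q"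
    "\<And>a w. w \<in> traj q \<Longrightarrow> (\<lambda>t. a \<cdot>\<^sub>v w t :: 'a vec) \<in> traj q"
    by (auto simp: traj_def)
  show ?thesis
    unfolding linear_behaviour_def
  proof (intro conjI ballI allI)
    show "(\<lambda>t. 0\<^sub>v q) \<in> ker_theta M"
      using ker_theta_pairing[OF M clos(1)] zero by simp
    fix v w assume "v \<in> ker_theta M" and w: "w \<in> ker_theta M"
    then have vw: "v \<in> traj q" "w \<in> traj q" using sub by auto
    have "pairing q w (row_comb M c) = 0" "pairing q v (row_comb M c) = 0" for c
      using \<open>v \<in> ker_theta M\<close> w ker_theta_pairing[OF M] vw by blast+
    then show "(\<lambda>t. v t + w t) \<in> ker_theta M"
      unfolding ker_theta_pairing[OF M clos(2)[OF vw]] add[OF vw] by simp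
  next
    fix a w assume "w \<in> ker_theta M"
    then have w: "w \<in> traj q" using sub by auto
    have "pairing q w (row_comb M c) = 0" for c
      using \<open>w \<in> ker_theta M\<close> ker_theta_pairing[OF M w] by blast
    then show "(\<lambda>t. a \<cdot>\<^sub>v w t) \<in> ker_theta M"
      unfolding ker_theta_pairing[OF M clos(3)[OF w]] scale[OF w] by simp
  qed (rule sub)
qed

lemma theta_shift: "theta M (\<lambda>t. w (t + i)) t = theta M w (t + i)"
proof -
  have "laurent_act p (\<lambda>u. w (u + i) $ j) t = laurent_act p (\<lambda>u. w u $ j) (t + i)" for p j
    using laurent_act_traj_shift[of p "\<lambda>u. w u $ j" i t] by simp
  then show ?thesis by (simp add: theta_def)
qed

lemma time_invariant_ker_theta: "time_invariant (ker_theta M)"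
  unfolding time_invariant_def
proof (intro ballI allI)
  fix w i assume w: "w \<in> ker_theta M"
  then have "(\<lambda>t. w (t + i)) \<in> traj (dim_col M)" by (auto simp: ker_theta_def traj_def)
  then show "(\<lambda>t. w (t + i)) \<in> ker_theta M"
    using w by (auto simp: ker_theta_def theta_shift fun_eq_iff)
qed

text \<open>The value of \<open>theta M w\<close> at a time \<open>t\<close> depends only on
  finitely many values of \<open>w\<close>, at distances from \<open>t\<close> bounded by the
  exponents in \<open>M\<close>. A window containing them certifies the equation at
  \<open>t\<close>.\<close>

lemma complete_behaviour_ker_theta:
  assumes M: "M \<in> carrier_mat n q"
  shows "complete_behaviour q (ker_theta M)"
  unfolding complete_behaviour_def
proof (intro ballI impI)
  fix w assume w: "w \<in> traj q" and window: "\<forall>t0 t1. t0 \<le> t1 \<longrightarrow>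
    restrict w {t0..t1} \<in> (\<lambda>v. restrict v {t0..t1}) ` ker_theta M"
  \<comment> \<open>The inserted 0 keeps the set nonempty when \<open>M\<close> has no nonzero
    entry, so that \<open>Min\<close> and \<open>Max\<close> are meaningful.\<close>
  define K where "K = insert 0 (\<Union>i<n. \<Union>j<q. Poly_Mapping.keys (M $$ (i, j)))"
  have fin: "finite K" and "0 \<in> K" by (simp_all add: K_def)
  have keys: "Poly_Mapping.keys (M $$ (i, j)) \<subseteq> K" if "i < n" "j < q" for i j
    using that by (auto simp: K_def)
  have "theta M w t = 0\<^sub>v n" for t
  proof -
    let ?I = "{t - Max K..t - Min K}"
    have "t - Max K \<le> t - Min K" 
      using Min_le[OF fin \<open>0 \<in> K\<close>] Max_ge[OF fin \<open>0 \<in> K\<close>] by simp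
    then obtain v where v: "v \<in> ker_theta M" and eq: "restrict w ?I = restrict v ?I"
      using window by blast
    have "w (t - k) = v (t - k)" if "k \<in> K" for k
    proof -
      have "t - k \<in> ?I" using Min_le[OF fin that] Max_ge[OF fin that] by simp
      then show ?thesis using fun_cong[OF eq, of "t - k"] by simp
    qed
    then have "laurent_act (M $$ (i, j)) (\<lambda>u. w u $ j) t = laurent_act (M $$ (i, j)) (\<lambda>u. v u $ j) t"
      if "i < n" "j < q" for i j
      unfolding laurent_act_def using keys[OF that] by (intro sum.cong) auto
    then have "theta M w t = theta M v t" using M by (auto simp: theta_def)
    then show ?thesis using v M by (auto simp: ker_theta_def)
  qed
  then show "w \<in> ker_theta M" using w M by (auto simp: ker_theta_def)
qed

section \<open>Epis of matrices, submodules of rows, and kernel representations\<close>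

lemma epi_MatI:
  assumes M: "M \<in> carrier_mat n m"
    and inj: "\<And>p g. g \<in> carrier_mat p n \<Longrightarrow> g * M = 0\<^sub>m p m \<Longrightarrow> g = 0\<^sub>m p n"
  shows "epi Mat m n M"
  unfolding epi_def
proof (intro conjI allI ballI impI)
  show "M \<in> Hom Mat m n" using M by (simp add: Mat_def)
  fix p and g h :: "'a laurent mat"
  assume "g \<in> Hom Mat n p" "h \<in> Hom Mat n p" and eq: "Cmp Mat g M = Cmp Mat h M"
  then have gh: "g \<in> carrier_mat p n" "h \<in> carrier_mat p n" by (simp_all add: Mat_def)
  have "(g - h) * M = g * M - h * M" using minus_mult_distrib_mat[OF gh M] .
  also have "\<dots> = 0\<^sub>m p m" using eq gh M by (simp add: Mat_def)
  finally have "g - h = 0\<^sub>m p n" using gh by (intro inj) auto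
  then have "(g - h) $$ (i, j) = 0" if "i < p" "j < n" for i j using that by simp
  then show "g = h" using gh by (intro eq_matI) auto
qed

lemma epi_Mat_carrier: "epi Mat m n M \<Longrightarrow> M \<in> carrier_mat n m"
  by (simp add: epi_def Mat_def)

lemma epi_Mat_cancel:
  assumes "epi Mat m n M" "g \<in> carrier_mat p n" "h \<in> carrier_mat p n" "g * M = h * M"
  shows "g = h"
  using assms by (auto simp: epi_def Mat_def)

lemma epi_Mat_cancel_0:
  assumes e: "epi Mat m n M" and g: "g \<in> carrier_mat p n" and z: "g * M = 0\<^sub>m p m"
  shows "g = 0\<^sub>m p n"
  using epi_Mat_cancel[OF e g zero_carrier_mat] z left_mult_zero_mat[OF epi_Mat_carrier[OF e]]
  by simp

text \<open>Epis of \<open>Mat\<close> are the matrices with linearly independent rows (so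
  \<open>s - 1\<close> is an epi), hence writing a basis as the rows of a matrix gives an epi.
  Independence of the basis is the cancellation property.\<close>

lemma submodule_row_space:
  fixes N :: "(nat \<Rightarrow> 'k::field laurent) set"
  assumes supp: "\<And>v j. v \<in> N \<Longrightarrow> q \<le> j \<Longrightarrow> v j = 0"
    and zero: "0 \<in> N"
    and add: "\<And>u v. u \<in> N \<Longrightarrow> v \<in> N \<Longrightarrow> u + v \<in> N"
    and mult: "\<And>c v. v \<in> N \<Longrightarrow> (\<lambda>j. c * v j) \<in> N"
  shows "\<exists>d E. epi Mat q d E \<and> N = range (row_comb E)"
proof -
  have "\<exists>(d::nat) e. (\<forall>i<d. e i \<in> N) \<and> (\<forall>v\<in>N. \<exists>c. \<forall>j. v j = (\<Sum>i<d. c i * e i j)) \<and>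
      (\<forall>c. (\<forall>j. (\<Sum>i<d. c i * e i j) = 0) \<longrightarrow> (\<forall>i<d. c i = 0))"
    by (rule submodule_basis[of N q]; fact assms)
  then obtain d :: nat and e where de: "(\<forall>i<d. e i \<in> N) \<and> (\<forall>v\<in>N. \<exists>c. \<forall>j. v j = (\<Sum>i<d. c i * e i j)) \<and>
      (\<forall>c. (\<forall>j. (\<Sum>i<d. c i * e i j) = 0) \<longrightarrow> (\<forall>i<d. c i = 0))"
    by (elim exE)
  have e: "\<And>i. i < d \<Longrightarrow> e i \<in> N"
    and span: "\<And>v. v \<in> N \<Longrightarrow> \<exists>c. \<forall>j. v j = (\<Sum>i<d. c i * e i j)"
    and ind: "\<And>c i. (\<And>j. (\<Sum>i<d. c i * e i j) = 0) \<Longrightarrow> i < d \<Longrightarrow> c i = 0"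
    using de by simp_all
  define E where "E = mat d q (\<lambda>(i, j). e i j)"
  have E: "E \<in> carrier_mat d q" by (simp add: E_def)
  have rc: "row_comb E c = (\<lambda>j. \<Sum>i<d. c i * e i j)" for c
    by (rule ext) (auto simp: row_comb_def E_def supp[OF e])
  have comb: "(\<lambda>j. \<Sum>i<k. c i * e i j) \<in> N" if "k \<le> d" for c k
    using that
  proof (induction k)
    case 0
    then show ?case using zero by (simp add: zero_fun_def)
  next
    case (Suc k)
    then have "(\<lambda>j. \<Sum>i<k. c i * e i j) + (\<lambda>j. c k * e k j) \<in> N"
      by (intro add mult e) auto
    then show ?case by (simp add: plus_fun_def)
  qed
  have "N = range (row_comb E)"
  proof
    show "N \<subseteq> range (row_comb E)"
    proof
      fix v assume "v \<in> N"
      then obtain c where "\<forall>j. v j = (\<Sum>i<d. c i * e i j)" using span by blast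
      then have "v = row_comb E c" unfolding rc by blast
      then show "v \<in> range (row_comb E)" by blast
    qed
    show "range (row_comb E) \<subseteq> N" unfolding rc using comb by blast
  qed
  moreover have "epi Mat q d E"
  proof (rule epi_MatI[OF E])
    fix p and g :: "'k laurent mat" assume g: "g \<in> carrier_mat p d" "g * E = 0\<^sub>m p q"
    have "row_fun g i k = 0" if "i < p" "k < d" for i k
    proof (rule ind[OF _ that(2)])
      fix j
      have "row_comb E (row_fun g i) = row_fun (0\<^sub>m p q) i"
        unfolding row_comb_row_fun[OF g(1) E that(1)] g(2) by simp
      then show "(\<Sum>k<d. row_fun g i k * e k j) = 0"
        unfolding rc using that by (auto simp: row_fun_def dest!: fun_cong[of _ _ j])
    qed
    then show "g = 0\<^sub>m p d" using g(1) by (intro eq_matI) (auto simp: row_fun_def)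
  qed
  ultimately show ?thesis by blast
qed

text \<open>Multiplying the row by \<open>s^i\<close> has the effect of shifting the trajectory by
  \<open>- i\<close>, which stays in \<open>B\<close>. This makes the annihilator of a
  time-invariant set a Laurent submodule instead of a mere \<open>k\<close>-subspace.\<close>

lemma pairing_mult_left:
  assumes "\<And>w. w \<in> B \<Longrightarrow> pairing q w v = 0" "time_invariant B" "w \<in> B"
  shows "pairing q w (\<lambda>j. c * v j) = 0"
proof (induction c rule: poly_mapping_sum_induct)
  case (single i a)
  have "laurent_act (v j) (\<lambda>u. w (u + (- i)) $ j) 0 = laurent_act (v j) (\<lambda>u. w u $ j) (- i)" for j
    using laurent_act_traj_shift[of "v j" "\<lambda>u. w u $ j" "- i" 0] by simp
  then have "pairing q w (\<lambda>j. Poly_Mapping.single i a * v j) = a * pairing q (\<lambda>t. w (t + (- i))) v"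
    by (simp add: pairing_def laurent_act_mult laurent_act_single sum_distrib_left)
  moreover have "(\<lambda>t. w (t + (- i))) \<in> B"
    using assms(2,3) unfolding time_invariant_def by blast
  ultimately show ?case using assms(1) by simp
next
  case (sum f g)
  then show ?case by (simp add: pairing_def distrib_right laurent_act_add sum.distrib)
qed

text \<open>The generating Laurent row of a window. It places windows inside the vector space in
  which functionals can be extended and represented.\<close>

definition window_row :: "nat \<Rightarrow> int set \<Rightarrow> (int \<Rightarrow> 'k::field vec) \<Rightarrow> (nat \<Rightarrow> 'k laurent)" where
  "window_row q I w = (\<lambda>j. if j < q then \<Sum>t\<in>I. Poly_Mapping.single t (w t $ j) else 0)"

lemma lookup_window_row:
  assumes "finite I" "j < q" "t \<in> I"
  shows "Poly_Mapping.lookup (window_row q I w j) t = w t $ j"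
proof -
  have "Poly_Mapping.lookup (window_row q I w j) t =
      (\<Sum>u\<in>I. if u = t then w u $ j else 0)"
    using assms by (simp add: window_row_def lookup_sum lookup_single when_def)
  then show ?thesis using assms by simp
qed

text \<open>Completeness reduces the claim to finite windows. There a trajectory outside the behaviour is
  separated from it by a functional, which by time invariance is an annihilating Laurent row.\<close>

lemma behaviour_is_kernel:
  fixes B :: "(int \<Rightarrow> 'k::field vec) set"
  assumes lin: "linear_behaviour q B" and ti: "time_invariant B" and comp: "complete_behaviour q B"
  shows "\<exists>d E. epi Mat q d E \<and> B = ker_theta E"
proof -
  define N where "N = {v. (\<forall>j\<ge>q. v j = 0) \<and> (\<forall>w\<in>B. pairing q w v = 0)}"
  have Btraj: "B \<subseteq> traj q" using lin by (simp add: linear_behaviour_def)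
  have "\<exists>d E. epi Mat q d E \<and> N = range (row_comb E)"
  proof (rule submodule_row_space)
    show "(0 :: nat \<Rightarrow> 'k laurent) \<in> N" by (simp add: N_def pairing_def)
    show "u + v \<in> N" if "u \<in> N" "v \<in> N" for u v
      using that by (simp add: N_def pairing_def laurent_act_add sum.distrib)
    show "(\<lambda>j. c * v j) \<in> N" if "v \<in> N" for c v
      using that pairing_mult_left[OF _ ti, of q v _ c] by (auto simp: N_def)
  qed (simp add: N_def)
  then obtain d E where epi: "epi Mat q d E" and N: "N = range (row_comb E)" by blast
  have E: "E \<in> carrier_mat d q" using epi by (rule epi_Mat_carrier)
  have "B \<subseteq> ker_theta E"
  proof
    fix w assume w: "w \<in> B"
    have "pairing q w (row_comb E c) = 0" for c
    proof -
      have "row_comb E c \<in> N" using N by blast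
      then show ?thesis using w by (simp add: N_def)
    qed
    then show "w \<in> ker_theta E" using w Btraj ker_theta_pairing[OF E] by blast
  qed
  moreover have "ker_theta E \<subseteq> B"
  proof
    fix w assume wE: "w \<in> ker_theta E"
    then have w: "w \<in> traj q" using E by (auto simp: ker_theta_def)
    have "restrict w {t0..t1} \<in> (\<lambda>v. restrict v {t0..t1}) ` B" for t0 t1
    proof (rule ccontr)
      let ?I = "{t0..t1}"
      assume nin: "restrict w ?I \<notin> (\<lambda>v. restrict v ?I) ` B"
      have fin: "finite ?I" by simp
      have notin: "window_row q ?I w \<notin> window_row q ?I ` B"
      proof
        assume "window_row q ?I w \<in> window_row q ?I ` B"
        then obtain b where b: "b \<in> B" "window_row q ?I w = window_row q ?I b" by blast
        have "b \<in> traj q" using b Btraj by blast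
        have "w t = b t" if "t \<in> ?I" for t
          using lookup_window_row[OF fin _ that, of _ q w] lookup_window_row[OF fin _ that, of _ q b]
            trajD[OF w] trajD[OF \<open>b \<in> traj q\<close>] b(2) by (intro eq_vecI) auto
        then have "restrict w ?I = restrict b ?I" by auto
        then show False using nin b(1) by blast
      qed
      have sub: "V.subspace (window_row q ?I ` B)"
        unfolding V.subspace_def
      proof (intro conjI ballI allI)
        have "window_row q ?I (\<lambda>t. 0\<^sub>v q) = (0 :: nat \<Rightarrow> 'k laurent)"
          by (auto simp: window_row_def)
        then show "(0 :: nat \<Rightarrow> 'k laurent) \<in> window_row q ?I ` B"
          using lin unfolding linear_behaviour_def by (metis image_eqI)
      next
        fix x y assume "x \<in> window_row q ?I ` B" "y \<in> window_row q ?I ` B"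
        then obtain a b where ab: "a \<in> B" "b \<in> B" "x = window_row q ?I a" "y = window_row q ?I b"
          by blast
        have "a \<in> traj q" "b \<in> traj q" using ab Btraj by auto
        then have "x + y = window_row q ?I (\<lambda>t. a t + b t)"
          unfolding ab by (auto simp: window_row_def trajD single_add sum.distrib)
        moreover have "(\<lambda>t. a t + b t) \<in> B" using lin ab by (auto simp: linear_behaviour_def)
        ultimately show "x + y \<in> window_row q ?I ` B" by blast
      next
        fix c x assume "x \<in> window_row q ?I ` B"
        then obtain a where a: "a \<in> B" "x = window_row q ?I a" by blast
        have "a \<in> traj q" using a Btraj by auto
        then have "vscale c x = window_row q ?I (\<lambda>t. c \<cdot>\<^sub>v a t)"
          unfolding a by (auto simp: window_row_def vscale_def trajD sum_distrib_left mult_single)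
        moreover have "(\<lambda>t. c \<cdot>\<^sub>v a t) \<in> B" using lin a by (auto simp: linear_behaviour_def)
        ultimately show "vscale c x \<in> window_row q ?I ` B" by blast
      qed
      obtain \<phi> where \<phi>: "Vector_Spaces.linear vscale (*) \<phi>"
        "\<forall>v\<in>window_row q ?I ` B. \<phi> v = 0" "\<phi> (window_row q ?I w) \<noteq> 0"
        using separating_functional[OF sub notin] by (elim exE conjE)
      obtain z where pz: "\<forall>v. (\<forall>j\<ge>q. v j = 0) \<longrightarrow> \<phi> v = pairing q z v"
        using functional_is_pairing[OF \<phi>(1), of q] by (elim bexE)
      \<comment> \<open>Evaluating \<open>z\<close> on a window row of \<open>w\<close> gives the
        sum of \<open>w t $ j * z (- t) $ j\<close>. Giving \<open>r\<close> the coefficient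
        \<open>z (- t) $ j\<close> at exponent \<open>- t\<close> makes its pairing with
        \<open>w\<close> the same sum, so the functional on windows becomes a row tested on whole
        trajectories.\<close>
      define r where
        "r = (\<lambda>j. if j < q then \<Sum>t\<in>?I. Poly_Mapping.single (- t) (z (- t) $ j) else 0)"
      have pr: "pairing q x r = \<phi> (window_row q ?I x)" for x
      proof -
        have "\<phi> (window_row q ?I x) = pairing q z (window_row q ?I x)"
          by (rule pz[rule_format]) (simp add: window_row_def)
        then show ?thesis
          by (simp add: pairing_def r_def window_row_def laurent_act_sum laurent_act_single
              mult.commute)
      qed
      have "r \<in> N" using \<phi>(2) by (simp add: N_def pr) (simp add: r_def)
      then obtain c where "r = row_comb E c" using N by blast
      then have "pairing q w r = 0" using wE ker_theta_pairing[OF E w] by simp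
      then show False using \<phi>(3) pr by simp
    qed
    then show "w \<in> B" using comp w unfolding complete_behaviour_def by blast
  qed
  ultimately show ?thesis using epi by blast
qed

lemma row_comb_mult: "row_comb M (\<lambda>j. c * v j) = (\<lambda>j. c * row_comb M v j)"
  by (rule ext) (simp add: row_comb_def sum_distrib_left mult.assoc)

text \<open>The left syzygies form a Laurent submodule, and \<open>L\<close> lists a basis. Both
  properties serve the universal property of a pushout: factorisation gives existence and
  \<open>epi\<close> gives uniqueness.\<close>

lemma left_kernel_basis:
  fixes M :: "'k::field laurent mat"
  assumes M: "M \<in> carrier_mat n m"
  shows "\<exists>l L. epi Mat n l L \<and> L * M = 0\<^sub>m l m \<and>
    (\<forall>p. \<forall>r\<in>carrier_mat p n. r * M = 0\<^sub>m p m \<longrightarrow> (\<exists>X\<in>carrier_mat p l. r = X * L))"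
proof -
  define N where "N = {v. (\<forall>j\<ge>n. v j = 0) \<and> row_comb M v = 0}"
  have "\<exists>d E. epi Mat n d E \<and> N = range (row_comb E)"
  proof (rule submodule_row_space)
    show "(0 :: nat \<Rightarrow> 'k laurent) \<in> N" by (auto simp: N_def row_comb_def)
    show "u + v \<in> N" if "u \<in> N" "v \<in> N" for u v
      using that linear_row_comb[of M] by (simp add: N_def Vector_Spaces.linear_iff)
    show "(\<lambda>j. c * v j) \<in> N" if "v \<in> N" for c v
      using that by (simp add: N_def row_comb_mult zero_fun_def)
  qed (simp add: N_def)
  then obtain l L where epi: "epi Mat n l L" and N: "N = range (row_comb L)" by blast
  have L: "L \<in> carrier_mat l n" using epi by (rule epi_Mat_carrier)
  have row_in_N: "row_fun r i \<in> N \<longleftrightarrow> row_fun (r * M) i = 0" if "r \<in> carrier_mat p n" "i < p" for r p i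
    using that row_comb_row_fun[OF that(1) M that(2)] by (auto simp: N_def row_fun_def)
  have zero_iff: "row_fun A i = 0 \<longleftrightarrow> (\<forall>j<m. A $$ (i, j) = 0)" if "A \<in> carrier_mat p m"
    for A :: "'k laurent mat" and p i
    using that by (auto simp: row_fun_def fun_eq_iff)
  have "L * M = 0\<^sub>m l m"
  proof (rule eq_matI)
    fix i j assume "i < dim_row (0\<^sub>m l m :: 'k laurent mat)" "j < dim_col (0\<^sub>m l m :: 'k laurent mat)"
    then have ij: "i < l" "j < m" by auto
    have "row_fun L i = row_comb L (row_fun (1\<^sub>m l) i)"
      using L ij by (simp add: row_comb_row_fun[of _ l l])
    then have "row_fun L i \<in> N" using N by blast
    then show "(L * M) $$ (i, j) = 0\<^sub>m l m $$ (i, j)"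
      using row_in_N[OF L ij(1)] zero_iff[of "L * M" l i] L M ij by simp
  qed (use L M in auto)
  moreover have "\<exists>X\<in>carrier_mat p l. r = X * L"
    if r: "r \<in> carrier_mat p n" and z: "r * M = 0\<^sub>m p m" for p r
  proof (rule factor_rows[OF r L])
    fix i assume "i < p"
    then have "row_fun r i \<in> N" using row_in_N[OF r] z zero_iff[of "0\<^sub>m p m" p i] by simp
    then show "row_fun r i \<in> range (row_comb L)" using N by blast
  qed
  ultimately show ?thesis using epi by blast
qed

section \<open>The prop of LTI behaviours\<close>

lemma copair_index:
  assumes "A \<in> carrier_mat d m" "B \<in> carrier_mat d n" "i < d" "j < m + n"
  shows "copair A B $$ (i, j) = (if j < m then A $$ (i, j) else B $$ (i, j - m))"
  using assms by (simp add: copair_def)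

lemma copair_splitE:
  fixes E :: "'a::zero mat"
  assumes E: "E \<in> carrier_mat d (m + n)"
  obtains A B where "A \<in> carrier_mat d m" "B \<in> carrier_mat d n" "E = copair A B"
proof
  let ?A = "mat d m (\<lambda>(i, j). E $$ (i, j))" and ?B = "mat d n (\<lambda>(i, j). E $$ (i, m + j))"
  show "?A \<in> carrier_mat d m" "?B \<in> carrier_mat d n" by auto
  then show "E = copair ?A ?B"
    using E by (intro eq_matI) (auto simp: copair_def)
qed

lemma copair_inject:
  assumes "A \<in> carrier_mat d m" "B \<in> carrier_mat d n" "A' \<in> carrier_mat d m" "B' \<in> carrier_mat d n"
  shows "copair A B = copair A' B' \<longleftrightarrow> A = A' \<and> B = B'"
proof
  assume eq: "copair A B = copair A' B'"
  have e: "copair A B $$ (i, j) = copair A' B' $$ (i, j)" for i j using eq by simp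
  show "A = A' \<and> B = B'"
  proof (intro conjI eq_matI)
    fix i j assume "i < dim_row A'" "j < dim_col A'"
    then show "A $$ (i, j) = A' $$ (i, j)"
      using e[of i j] assms by (simp add: copair_index[of _ d m _ n])
  next
    fix i j assume "i < dim_row B'" "j < dim_col B'"
    then show "B $$ (i, j) = B' $$ (i, j)"
      using e[of i "m + j"] assms by (simp add: copair_index[of _ d m _ n])
  qed (use assms in auto)
qed simp

lemma mult_copair:
  fixes g :: "'a::comm_ring_1 mat"
  assumes "A \<in> carrier_mat d m" "B \<in> carrier_mat d n" "g \<in> carrier_mat p d"
  shows "g * copair A B = copair (g * A) (g * B)"
proof (rule eq_matI)
  fix i j assume "i < dim_row (copair (g * A) (g * B))" "j < dim_col (copair (g * A) (g * B))"
  then have ij: "i < p" "j < m + n" using assms by (auto simp: copair_def)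
  then show "(g * copair A B) $$ (i, j) = copair (g * A) (g * B) $$ (i, j)"
    using assms by (auto simp: copair_def scalar_prod_def intro!: sum.cong)
qed (use assms in \<open>auto simp: copair_def\<close>)

lemma copair_mult_append_rows:
  fixes A :: "'a::comm_ring_1 mat"
  assumes "A \<in> carrier_mat p a" "B \<in> carrier_mat p b" "C \<in> carrier_mat a n" "D \<in> carrier_mat b n"
  shows "copair A B * (C @\<^sub>r D) = A * C + B * D"
proof (rule eq_matI)
  fix i j assume "i < dim_row (A * C + B * D)" "j < dim_col (A * C + B * D)"
  then have ij: "i < p" "j < n" using assms by auto
  then show "(copair A B * (C @\<^sub>r D)) $$ (i, j) = (A * C + B * D) $$ (i, j)"
    using assms
    by (auto simp: copair_def append_rows_def scalar_prod_def atLeast0LessThan sum_lessThan_add)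
qed (use assms in \<open>auto simp: copair_def append_rows_def\<close>)

lemma copair_mult_block_diag:
  fixes A :: "'a::comm_ring_1 mat"
  assumes "A \<in> carrier_mat p a" "B \<in> carrier_mat p b" "C \<in> carrier_mat a m" "D \<in> carrier_mat b n"
  shows "copair A B * block_diag C D = copair (A * C) (B * D)"
proof (rule eq_matI)
  fix i j assume "i < dim_row (copair (A * C) (B * D))" "j < dim_col (copair (A * C) (B * D))"
  then have ij: "i < p" "j < m + n" using assms by (auto simp: copair_def)
  then show "(copair A B * block_diag C D) $$ (i, j) = copair (A * C) (B * D) $$ (i, j)"
    using assms
    by (auto simp: copair_def block_diag_def scalar_prod_def atLeast0LessThan sum_lessThan_add)
qed (use assms in \<open>auto simp: copair_def block_diag_def\<close>)

lemma copair_zero [simp]: "copair (0\<^sub>m d m) (0\<^sub>m d n) = 0\<^sub>m d (m + n)"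
  by (rule eq_matI) (auto simp: copair_def)

lemma copair_eq_0_iff:
  "A \<in> carrier_mat d m \<Longrightarrow> B \<in> carrier_mat d n \<Longrightarrow>
    copair A B = 0\<^sub>m d (m + n) \<longleftrightarrow> A = 0\<^sub>m d m \<and> B = 0\<^sub>m d n"
  using copair_inject[of A d m B n "0\<^sub>m d m" "0\<^sub>m d n"] by simp

lemma block_diag_carrier [intro, simp]:
  "A \<in> carrier_mat a m \<Longrightarrow> B \<in> carrier_mat b n \<Longrightarrow> block_diag A B \<in> carrier_mat (a + b) (m + n)"
  by (auto simp: block_diag_def)

lemma swap_mat_carrier [intro, simp]: "swap_mat m n \<in> carrier_mat (n + m) (m + n)"
  by (auto simp: swap_mat_def)

lemma theta_append_rows:
  assumes "A \<in> carrier_mat a m" "B \<in> carrier_mat b m"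
  shows "theta (A @\<^sub>r B) x = traj_join (theta A x) (theta B x)"
  by (rule ext, rule eq_vecI)
    (use assms in \<open>auto simp: append_rows_def traj_join_def theta_index\<close>)

lemma theta_block_diag:
  assumes "A \<in> carrier_mat a m" "B \<in> carrier_mat b n" and x: "x \<in> traj m" and y: "y \<in> traj n"
  shows "theta (block_diag A B) (traj_join x y) = traj_join (theta A x) (theta B y)"
proof (rule ext, rule eq_vecI)
  fix t i assume "i < dim_vec (traj_join (theta A x) (theta B y) t)"
  then show "theta (block_diag A B) (traj_join x y) t $ i = traj_join (theta A x) (theta B y) t $ i"
    using assms
    by (auto simp: theta_index block_diag_def traj_join_def sum_lessThan_add trajD[OF x] trajD[OF y])
qed (use assms in \<open>auto simp: block_diag_def traj_join_def\<close>)

lemma theta_zero: "theta (0\<^sub>m n m) x = (\<lambda>t. 0\<^sub>v n)"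
  by (rule ext, rule eq_vecI) (auto simp: theta_index)

lemma theta_swap_mat:
  fixes x :: "int \<Rightarrow> 'k::field vec"
  assumes x: "x \<in> traj m" and y: "y \<in> traj n"
  shows "theta (swap_mat m n) (traj_join x y) = traj_join y x"
proof -
  let ?z = "0\<^sub>m :: nat \<Rightarrow> nat \<Rightarrow> 'k laurent mat" and ?i = "1\<^sub>m :: nat \<Rightarrow> 'k laurent mat"
  have swap: "swap_mat m n = copair (?z n m) (?i n) @\<^sub>r copair (?i m) (?z m n)"
    by (rule eq_matI) (auto simp: swap_mat_def copair_def append_rows_def)
  have "theta (copair (?z n m) (?i n)) (traj_join x y) = y"
    by (subst theta_copair[OF zero_carrier_mat one_carrier_mat x y])
      (use y in \<open>auto simp: theta_zero theta_one traj_def\<close>)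
  moreover have "theta (copair (?i m) (?z m n)) (traj_join x y) = x"
    by (subst theta_copair[OF one_carrier_mat zero_carrier_mat x y])
      (use x in \<open>auto simp: theta_zero theta_one traj_def\<close>)
  moreover have "copair (?z n m) (?i n) \<in> carrier_mat n (m + n)"
    "copair (?i m) (?z m n) \<in> carrier_mat m (m + n)" by auto
  ultimately show ?thesis by (simp add: swap theta_append_rows[of _ n "m + n" _ m])
qed

section \<open>Jointly epic cospans and the behaviours they represent\<close>

lemma epi_copair_iff:
  assumes AB: "A \<in> carrier_mat d m" "B \<in> carrier_mat d n"
  shows "epi Mat (m + n) d (copair A B) \<longleftrightarrow>
    (\<forall>p. \<forall>g\<in>carrier_mat p d. g * A = 0\<^sub>m p m \<longrightarrow> g * B = 0\<^sub>m p n \<longrightarrow> g = 0\<^sub>m p d)"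
  (is "?L \<longleftrightarrow> ?R")
proof
  assume ?L
  then show ?R
    using AB by (auto intro!: epi_Mat_cancel_0[of "m + n" d "copair A B"] simp: mult_copair[OF AB])
next
  assume R: ?R
  show ?L
  proof (rule epi_MatI)
    fix p g assume "g \<in> carrier_mat p d" "g * copair A B = 0\<^sub>m p (m + n)"
    then show "g = 0\<^sub>m p d"
      using R AB copair_eq_0_iff[of "g * A" p m "g * B" n] by (simp add: mult_copair[OF AB])
  qed (use AB in auto)
qed

lemma jointly_epic_iff:
  "jointly_epic m n d A B \<longleftrightarrow> A \<in> carrier_mat d m \<and> B \<in> carrier_mat d n \<and>
    (\<forall>p. \<forall>g\<in>carrier_mat p d. g * A = 0\<^sub>m p m \<longrightarrow> g * B = 0\<^sub>m p n \<longrightarrow> g = 0\<^sub>m p d)"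
  using epi_copair_iff[of A d m B n] by (auto simp: jointly_epic_def Mat_def)

lemma jointly_epic_carrier:
  "jointly_epic m n d A B \<Longrightarrow> A \<in> carrier_mat d m"
  "jointly_epic m n d A B \<Longrightarrow> B \<in> carrier_mat d n"
  by (simp_all add: jointly_epic_iff)

lemma jointly_epic_cancel:
  assumes je: "jointly_epic m n d A B" and gh: "g \<in> carrier_mat p d" "h \<in> carrier_mat p d"
    and eq: "g * A = h * A" "g * B = h * B"
  shows "g = h"
proof -
  have "epi Mat (m + n) d (copair A B)" using je by (simp add: jointly_epic_def)
  then show ?thesis
    using gh
    by (rule epi_Mat_cancel)
      (simp only: mult_copair[OF jointly_epic_carrier[OF je] gh(1)]
        mult_copair[OF jointly_epic_carrier[OF je] gh(2)] eq)
qed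

lemma LTI_behaviour_of:
  assumes AB: "A \<in> carrier_mat d m" "B \<in> carrier_mat d n"
  shows "behaviour_of A B \<in> LTI_behaviours m n"
proof -
  have M: "copair A (- B) \<in> carrier_mat d (m + n)" using AB by simp
  show ?thesis
    using AB linear_behaviour_ker_theta[OF M] time_invariant_ker_theta[of "copair A (- B)"]
      complete_behaviour_ker_theta[OF M]
    unfolding LTI_behaviours_def Let_def mem_Collect_eq traj_join_behaviour_of[OF AB]
    by (auto simp: behaviour_of_def)
qed

lemma LTI_behaviour_representation:
  fixes S :: "'k::field behaviour"
  assumes S: "S \<in> LTI_behaviours m n"
  obtains d A B where "jointly_epic m n d A B" "behaviour_of A B = S"
proof -
  let ?J = "\<lambda>(x, y). traj_join x y"
  have sub: "S \<subseteq> traj m \<times> traj n" and "linear_behaviour (m + n) (?J ` S)"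
    "time_invariant (?J ` S)" "complete_behaviour (m + n) (?J ` S)"
    using S by (simp_all add: LTI_behaviours_def Let_def)
  then obtain d E where epi: "epi Mat (m + n) d E" and ker: "?J ` S = ker_theta E"
    using behaviour_is_kernel by blast
  obtain A C where A: "A \<in> carrier_mat d m" and C: "C \<in> carrier_mat d n" and E: "E = copair A C"
    by (rule copair_splitE[OF epi_Mat_carrier[OF epi]])
  \<comment> \<open>A kernel matrix presents the equation \<open>A x + C y = 0\<close>; negating the
    second block gives the cospan form \<open>A x = B y\<close> and leaves joint epicness
    unchanged.\<close>
  define B where "B = - C"
  have B: "B \<in> carrier_mat d n" and CB: "C = - B" using C by (auto simp: B_def)
  have "g = 0\<^sub>m p d" if "g \<in> carrier_mat p d" "g * A = 0\<^sub>m p m" "g * B = 0\<^sub>m p n" for p g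
  proof -
    have "- 0\<^sub>m p n = (0\<^sub>m p n :: 'k laurent mat)" by (rule eq_matI) auto
    then have "g * C = 0\<^sub>m p n" using that B unfolding CB by simp
    then show ?thesis using epi that unfolding E epi_copair_iff[OF A C] by blast
  qed
  then have je: "jointly_epic m n d A B" using A B by (simp add: jointly_epic_iff)
  have "(x, y) \<in> behaviour_of A B \<longleftrightarrow> (x, y) \<in> S" for x y
  proof (cases "x \<in> traj m \<and> y \<in> traj n")
    case True
    then have "(x, y) \<in> behaviour_of A B \<longleftrightarrow> traj_join x y \<in> ?J ` S"
      using in_behaviour_of[OF A B] ker E CB by simp
    also have "\<dots> \<longleftrightarrow> (x, y) \<in> S"
      using sub True traj_join_inject[of x m] by fastforce
    finally show ?thesis .
  qed (use sub A B in \<open>auto simp: behaviour_of_def\<close>)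
  then have "behaviour_of A B = S" by auto
  then show ?thesis using that je by blast
qed

lemma LTI_behaviours_subset: "S \<in> LTI_behaviours m n \<Longrightarrow> S \<subseteq> traj m \<times> traj n"
  by (simp add: LTI_behaviours_def)

lemma behaviour_of_iff:
  assumes "A \<in> carrier_mat d m" "B \<in> carrier_mat d n"
  shows "(x, y) \<in> behaviour_of A B \<longleftrightarrow> x \<in> traj m \<and> y \<in> traj n \<and> theta A x = theta B y"
  using assms by (auto simp: behaviour_of_def)

lemma behaviour_of_block_diag:
  assumes A: "A \<in> carrier_mat d m" and B: "B \<in> carrier_mat d n"
    and C: "C \<in> carrier_mat d' m'" and D: "D \<in> carrier_mat d' n'"
  shows "behaviour_of (block_diag A C) (block_diag B D) =
    Tns LTI (behaviour_of A B) (behaviour_of C D)"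
proof -
  note iff = behaviour_of_iff[OF block_diag_carrier[OF A C] block_diag_carrier[OF B D]]
    behaviour_of_iff[OF A B] behaviour_of_iff[OF C D]
  have inj: "traj_join (theta A x) (theta C x') = traj_join (theta B y) (theta D y') \<longleftrightarrow>
      theta A x = theta B y \<and> theta C x' = theta D y'" for x x' y y'
    using theta_in_traj[OF A] theta_in_traj[OF B] by (rule traj_join_inject)
  show ?thesis
  proof (intro equalityI subrelI)
    fix w z assume L: "(w, z) \<in> behaviour_of (block_diag A C) (block_diag B D)"
    obtain x x' where x: "x \<in> traj m" "x' \<in> traj m'" "w = traj_join x x'"
      using L by (auto simp: iff elim: traj_splitE)
    obtain y y' where y: "y \<in> traj n" "y' \<in> traj n'" "z = traj_join y y'"
      using L by (auto simp: iff elim: traj_splitE)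
    have "(x, y) \<in> behaviour_of A B" "(x', y') \<in> behaviour_of C D"
      using L x y theta_block_diag[OF A C x(1,2)] theta_block_diag[OF B D y(1,2)]
      by (simp_all add: iff inj)
    then show "(w, z) \<in> Tns LTI (behaviour_of A B) (behaviour_of C D)"
      unfolding x y by (auto simp: LTI_def)
  next
    fix w z assume "(w, z) \<in> Tns LTI (behaviour_of A B) (behaviour_of C D)"
    then obtain x x' y y' where wz: "w = traj_join x x'" "z = traj_join y y'"
      "(x, y) \<in> behaviour_of A B" "(x', y') \<in> behaviour_of C D"
      by (auto simp: LTI_def)
    then have "x \<in> traj m" "x' \<in> traj m'" "y \<in> traj n" "y' \<in> traj n'"
      by (simp_all add: iff)
    then show "(w, z) \<in> behaviour_of (block_diag A C) (block_diag B D)"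
      using wz by (simp add: iff theta_block_diag[OF A C] theta_block_diag[OF B D] traj_join_in_traj)
  qed
qed

lemma behaviour_of_one: "behaviour_of (1\<^sub>m n) (1\<^sub>m n) = Idn LTI n"
  by (auto simp: behaviour_of_def LTI_def theta_one)

lemma behaviour_of_swap: "behaviour_of (swap_mat m n) (1\<^sub>m (n + m)) = Sym LTI m n"
proof (intro equalityI subrelI)
  note iff = behaviour_of_iff[OF swap_mat_carrier one_carrier_mat]
  fix w z :: "int \<Rightarrow> 'a vec"
  {
    assume L: "(w, z) \<in> behaviour_of (swap_mat m n) (1\<^sub>m (n + m))"
    obtain x y where xy: "x \<in> traj m" "y \<in> traj n" "w = traj_join x y"
      using L by (auto simp: iff elim: traj_splitE)
    then have "z = traj_join y x" using L by (simp add: iff theta_one theta_swap_mat)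
    then show "(w, z) \<in> Sym LTI m n" using xy by (auto simp: LTI_def)
  next
    assume "(w, z) \<in> Sym LTI m n"
    then obtain x y where "x \<in> traj m" "y \<in> traj n" "w = traj_join x y" "z = traj_join y x"
      by (auto simp: LTI_def)
    then show "(w, z) \<in> behaviour_of (swap_mat m n) (1\<^sub>m (n + m))"
      by (simp add: iff theta_one theta_swap_mat traj_join_in_traj)
  }
qed

section \<open>Pushouts and closure of behaviours under the prop operations\<close>

lemma pushout_exists:
  fixes B C :: "'k::field laurent mat"
  assumes B: "B \<in> carrier_mat a n" and C: "C \<in> carrier_mat b n"
  shows "\<exists>e P Q. is_pushout Mat n a b e B C P Q"
proof -
  have BC: "B @\<^sub>r C \<in> carrier_mat (a + b) n" using B C by auto
  \<comment> \<open>A cocone \<open>p B = q C\<close> is the syzygy \<open>[p -q]\<close>, and its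
    mediating arrow is its factor through \<open>L\<close>. A mere generating family of syzygies
    would leave this factor ambiguous; a basis determines it. The legs are \<open>P\<close> and
    \<open>- Q'\<close>.\<close>
  obtain e L where epi: "epi Mat (a + b) e L" and LM: "L * (B @\<^sub>r C) = 0\<^sub>m e n"
    and fac: "\<forall>p. \<forall>r\<in>carrier_mat p (a + b). r * (B @\<^sub>r C) = 0\<^sub>m p n \<longrightarrow>
      (\<exists>X\<in>carrier_mat p e. r = X * L)"
    using left_kernel_basis[OF BC] by (elim exE conjE)
  obtain P Q' where P: "P \<in> carrier_mat e a" and Q': "Q' \<in> carrier_mat e b" and L: "L = copair P Q'"
    by (rule copair_splitE[OF epi_Mat_carrier[OF epi]])
  have neg_neg: "- (- M) = M" for M :: "'k laurent mat" by (rule eq_matI) auto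
  have opp: "g = - h" if "g + h = 0\<^sub>m p q" "g \<in> carrier_mat p q" "h \<in> carrier_mat p q"
    for g h :: "'k laurent mat" and p q
  proof (rule eq_matI)
    fix i j assume "i < dim_row (- h)" "j < dim_col (- h)"
    then show "g $$ (i, j) = (- h) $$ (i, j)"
      using arg_cong[OF that(1), of "\<lambda>M. M $$ (i, j)"] that(2,3)
      by (simp add: eq_neg_iff_add_eq_0)
  qed (use that in auto)
  have "P * B + Q' * C = 0\<^sub>m e n"
    using LM copair_mult_append_rows[OF P Q' B C] by (simp add: L)
  then have comm: "P * B = - Q' * C" using opp[of "P * B" "Q' * C" e n] P Q' B C by simp
  have univ: "\<exists>!u. u \<in> carrier_mat f e \<and> u * P = p \<and> u * (- Q') = q"
    if p: "p \<in> carrier_mat f a" and q: "q \<in> carrier_mat f b" and eq: "p * B = q * C" for f p q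
  proof -
    have "copair p (- q) * (B @\<^sub>r C) = p * B + - q * C"
      using p q B C by (intro copair_mult_append_rows) auto
    also have "\<dots> = 0\<^sub>m f n" unfolding eq using q C by (intro eq_matI) auto
    finally obtain X where X: "X \<in> carrier_mat f e" "copair p (- q) = X * L"
      using fac copair_carrier[OF p uminus_carrier_mat[OF q]] by blast
    then have "copair p (- q) = copair (X * P) (X * Q')"
      by (simp add: L mult_copair[OF P Q'])
    then have "X * P = p" "- q = X * Q'"
      using copair_inject[OF p uminus_carrier_mat[OF q] mult_carrier_mat[OF X(1) P]
          mult_carrier_mat[OF X(1) Q']] by simp_all
    have XQ: "X * (- Q') = q"
      using \<open>- q = X * Q'\<close>[symmetric] X(1) Q' neg_neg[of q] by simp
    have uniq: "u = X" if u: "u \<in> carrier_mat f e" "u * P = p" "u * (- Q') = q" for u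
    proof (rule epi_Mat_cancel[OF epi u(1) X(1)])
      have "u * (- Q') = X * (- Q')" using u(3) XQ by (rule trans[OF _ sym])
      then have "u * Q' = X * Q'" using u(1) X(1) Q' by simp
      then show "u * L = X * L"
        unfolding L mult_copair[OF P Q' u(1)] mult_copair[OF P Q' X(1)] u(2) \<open>X * P = p\<close>
        by simp
    qed
    show ?thesis
    proof (rule ex1I[of _ X])
      show "X \<in> carrier_mat f e \<and> X * P = p \<and> X * (- Q') = q"
        using X(1) \<open>X * P = p\<close> XQ by blast
      show "u = X" if "u \<in> carrier_mat f e \<and> u * P = p \<and> u * (- Q') = q" for u
        using that uniq by blast
    qed
  qed
  have "is_pushout Mat n a b e B C P (- Q')"
    unfolding is_pushout_def Mat_def prop_data.simps
    by (intro conjI allI ballI impI univ) (use B C P Q' comm in auto)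
  then show ?thesis by blast
qed

text \<open>\<open>y\<close> with \<open>B y = A x\<close> and \<open>C y = D z\<close> exists because the pushout relations are all left
  syzygies of the span.\<close>

lemma behaviour_of_pushout:
  fixes A B C D :: "'k::field laurent mat"
  assumes A: "A \<in> carrier_mat a m" and D: "D \<in> carrier_mat b l"
    and po: "is_pushout Mat n a b e B C P Q"
  shows "behaviour_of (P * A) (Q * D) = behaviour_of A B O behaviour_of C D"
proof -
  have B: "B \<in> carrier_mat a n" and C: "C \<in> carrier_mat b n"
    and P: "P \<in> carrier_mat e a" and Q: "Q \<in> carrier_mat e b" and comm: "P * B = Q * C"
    using po by (simp_all add: is_pushout_def Mat_def)
  note iff = behaviour_of_iff[OF A B] behaviour_of_iff[OF C D]
    behaviour_of_iff[OF mult_carrier_mat[OF P A] mult_carrier_mat[OF Q D]]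
  have BC: "B @\<^sub>r C \<in> carrier_mat (a + b) n" using B C by auto
  have PQ: "copair P (- Q) \<in> carrier_mat e (a + b)" using P Q by simp
  show ?thesis
  proof (intro equalityI subrelI)
    fix x z assume xz: "(x, z) \<in> behaviour_of (P * A) (Q * D)"
    then have x: "x \<in> traj m" and z: "z \<in> traj l"
      and eq: "theta P (theta A x) = theta Q (theta D z)"
      by (simp_all add: iff theta_mult[OF P A] theta_mult[OF Q D])
    have Ax: "theta A x \<in> traj a" and Dz: "theta D z \<in> traj b"
      using A D by (auto intro: theta_in_traj)
    then have ker: "traj_join (theta A x) (theta D z) \<in> ker_theta (copair P (- Q))"
      unfolding in_behaviour_of[OF P Q Ax Dz] behaviour_of_iff[OF P Q] using eq by simp
    have "\<exists>y\<in>traj n. theta (B @\<^sub>r C) y = traj_join (theta A x) (theta D z)"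
    proof (rule theta_solvable[OF BC PQ _ ker])
      fix r :: "'k laurent mat"
      assume r: "r \<in> carrier_mat 1 (a + b)" and r0: "r * (B @\<^sub>r C) = 0\<^sub>m 1 n"
      obtain p q where p: "p \<in> carrier_mat 1 a" and q: "q \<in> carrier_mat 1 b" and rpq: "r = copair p q"
        by (rule copair_splitE[OF r])
      have sum0: "p * B + q * C = 0\<^sub>m 1 n"
        using r0 copair_mult_append_rows[OF p q B C] by (simp add: rpq)
      have "p * B = - q * C"
      proof (rule eq_matI)
        fix i j assume "i < dim_row (- q * C)" "j < dim_col (- q * C)"
        then show "(p * B) $$ (i, j) = (- q * C) $$ (i, j)"
          using arg_cong[OF sum0, of "\<lambda>M. M $$ (i, j)"] p q B C
          by (simp add: eq_neg_iff_add_eq_0)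
      qed (use p q B C in auto)
      \<comment> \<open>A syzygy with one row is a cocone with apex 1. Only the universal property
        is used, so the argument covers every pushout, as composition of corelations ranges over all
        of them.\<close>
      then have "\<exists>!u. u \<in> carrier_mat 1 e \<and> u * P = p \<and> u * Q = - q"
        using po p q by (simp add: is_pushout_def Mat_def)
      then obtain u where u: "u \<in> carrier_mat 1 e" "u * P = p" "u * Q = - q" by blast
      have "- (- q) = q" by (rule eq_matI) auto
      then have "u * - Q = q" using u Q by simp
      then have "u * copair P (- Q) = r"
        using u by (simp add: mult_copair[OF P uminus_carrier_mat[OF Q]] rpq)
      then show "\<exists>X\<in>carrier_mat 1 e. r = X * copair P (- Q)" using u(1) by blast
    qed
    then obtain y where y: "y \<in> traj n" "theta (B @\<^sub>r C) y = traj_join (theta A x) (theta D z)"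
      by blast
    then have "theta B y = theta A x" "theta C y = theta D z"
      using traj_join_inject[OF theta_in_traj[OF B] Ax] by (simp_all add: theta_append_rows[OF B C])
    then show "(x, z) \<in> behaviour_of A B O behaviour_of C D"
      using x y(1) z by (intro relcompI[of x y]) (simp_all add: iff)
  next
    fix x z assume "(x, z) \<in> behaviour_of A B O behaviour_of C D"
    then obtain y where xy: "(x, y) \<in> behaviour_of A B" and yz: "(y, z) \<in> behaviour_of C D" by blast
    have "theta P (theta A x) = theta (P * B) y"
      using xy by (simp add: iff theta_mult[OF P B])
    also have "\<dots> = theta Q (theta D z)"
      unfolding comm using yz by (simp add: iff theta_mult[OF Q C])
    finally show "(x, z) \<in> behaviour_of (P * A) (Q * D)"
      using xy yz by (simp add: iff theta_mult[OF P A] theta_mult[OF Q D])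
  qed
qed

text \<open>Completeness of a composite is not evident from the definition, because intermediate
  trajectories found on different windows need not agree. Presenting the composite as the behaviour
  of a pushout cospan settles it.\<close>

lemma LTI_relcomp:
  fixes S T :: "'k::field behaviour"
  assumes "S \<in> LTI_behaviours m n" "T \<in> LTI_behaviours n l"
  shows "S O T \<in> LTI_behaviours m l"
proof -
  obtain d A B where AB: "jointly_epic m n d A B" "behaviour_of A B = S"
    by (rule LTI_behaviour_representation[OF assms(1)])
  obtain d' C D where CD: "jointly_epic n l d' C D" "behaviour_of C D = T"
    by (rule LTI_behaviour_representation[OF assms(2)])
  note carr = jointly_epic_carrier[OF AB(1)] jointly_epic_carrier[OF CD(1)]
  obtain e P Q where po: "is_pushout Mat n d d' e B C P Q"
    using pushout_exists[OF carr(2,3)] by blast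
  then have "P \<in> carrier_mat e d" "Q \<in> carrier_mat e d'"
    by (simp_all add: is_pushout_def Mat_def)
  then have "behaviour_of (P * A) (Q * D) \<in> LTI_behaviours m l"
    using carr by (intro LTI_behaviour_of) auto
  then show ?thesis
    using behaviour_of_pushout[OF carr(1,4) po] AB CD by simp
qed

lemma LTI_Tns:
  fixes S T :: "'k::field behaviour"
  assumes "S \<in> LTI_behaviours m n" "T \<in> LTI_behaviours m' n'"
  shows "Tns LTI S T \<in> LTI_behaviours (m + m') (n + n')"
proof -
  obtain d A B where AB: "jointly_epic m n d A B" "behaviour_of A B = S"
    by (rule LTI_behaviour_representation[OF assms(1)])
  obtain d' C D where CD: "jointly_epic m' n' d' C D" "behaviour_of C D = T"
    by (rule LTI_behaviour_representation[OF assms(2)])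
  note carr = jointly_epic_carrier[OF AB(1)] jointly_epic_carrier[OF CD(1)]
  show ?thesis
    using behaviour_of_block_diag[OF carr] AB CD
      LTI_behaviour_of[OF block_diag_carrier[OF carr(1,3)] block_diag_carrier[OF carr(2,4)]]
    by simp
qed

section \<open>Relations of trajectories satisfy the prop axioms\<close>

lemma LTI_nonempty: "S \<in> LTI_behaviours m n \<Longrightarrow> S \<noteq> {}"
  by (auto simp: LTI_behaviours_def linear_behaviour_def Let_def)

lemma traj_disjoint: "x \<in> traj m \<Longrightarrow> x \<in> traj n \<Longrightarrow> m = n"
  using trajD by metis

lemma traj_join_assoc: "traj_join (traj_join x y) z = traj_join x (traj_join y z)"
  by (rule ext, rule eq_vecI) (auto simp: traj_join_def)

lemma traj_0_unit:
  assumes "x \<in> traj 0"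
  shows "traj_join x y = y" "traj_join y x = y"
  by (rule ext, rule eq_vecI; simp add: traj_join_def trajD[OF assms])+

lemma traj_0_exists: "\<exists>x. x \<in> traj 0"
  by (rule exI[of _ "\<lambda>t. vec 0 (\<lambda>i. undefined)"]) (simp add: traj_def)

lemma Hom_LTI [simp]: "Hom LTI = LTI_behaviours"
  and Cmp_LTI: "Cmp LTI T S = S O T"
  by (simp_all add: LTI_def)

lemma Tns_LTI_I:
  "(x, y) \<in> R \<Longrightarrow> (x', y') \<in> S \<Longrightarrow> (traj_join x x', traj_join y y') \<in> Tns LTI R S"
  by (auto simp: LTI_def)

lemma Tns_LTI_E:
  assumes "(w, z) \<in> Tns LTI R S"
  obtains x y x' y' where "w = traj_join x x'" "z = traj_join y y'" "(x, y) \<in> R" "(x', y') \<in> S"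
  using assms by (auto simp: LTI_def)

lemma Sym_LTI_I: "x \<in> traj m \<Longrightarrow> y \<in> traj n \<Longrightarrow> (traj_join x y, traj_join y x) \<in> Sym LTI m n"
  by (auto simp: LTI_def)

lemma Sym_LTI_E:
  assumes "(w, z) \<in> Sym LTI m n"
  obtains x y where "w = traj_join x y" "z = traj_join y x" "x \<in> traj m" "y \<in> traj n"
  using assms by (auto simp: LTI_def)

lemma Idn_LTI_iff: "(x, y) \<in> Idn LTI n \<longleftrightarrow> x = y \<and> x \<in> traj n"
  by (auto simp: LTI_def)

lemma LTI_mem:
  "S \<in> LTI_behaviours m n \<Longrightarrow> (x, y) \<in> S \<Longrightarrow> x \<in> traj m"
  "S \<in> LTI_behaviours m n \<Longrightarrow> (x, y) \<in> S \<Longrightarrow> y \<in> traj n"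
  using LTI_behaviours_subset by blast+

lemma Tns_LTI_assoc: "Tns LTI (Tns LTI f g) h = Tns LTI f (Tns LTI g h)"
proof (intro equalityI subrelI)
  fix x y assume "(x, y) \<in> Tns LTI (Tns LTI f g) h"
  then obtain v v' c c' where 1: "x = traj_join v c" "y = traj_join v' c'" "(c, c') \<in> h"
    and v: "(v, v') \<in> Tns LTI f g" by (rule Tns_LTI_E)
  from v obtain a a' b b' where "v = traj_join a b" "v' = traj_join a' b'"
    "(a, a') \<in> f" "(b, b') \<in> g" by (rule Tns_LTI_E)
  then show "(x, y) \<in> Tns LTI f (Tns LTI g h)"
    using 1 by (simp add: traj_join_assoc Tns_LTI_I)
next
  fix x y assume "(x, y) \<in> Tns LTI f (Tns LTI g h)"
  then obtain v v' a a' where 1: "x = traj_join a v" "y = traj_join a' v'" "(a, a') \<in> f"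
    and v: "(v, v') \<in> Tns LTI g h" by (rule Tns_LTI_E)
  from v obtain b b' c c' where "v = traj_join b c" "v' = traj_join b' c'"
    "(b, b') \<in> g" "(c, c') \<in> h" by (rule Tns_LTI_E)
  then show "(x, y) \<in> Tns LTI (Tns LTI f g) h"
    using 1 by (simp add: traj_join_assoc[symmetric] Tns_LTI_I)
qed

text \<open>A behaviour contains at least the zero pair, and any pair in it reveals both
  dimensions.\<close>

lemma LTI_behaviours_disjoint:
  assumes "(m, n) \<noteq> (m', n')"
  shows "LTI_behaviours m n \<inter> LTI_behaviours m' n' = ({} :: 'k::field behaviour set)"
proof (rule ccontr)
  assume "LTI_behaviours m n \<inter> LTI_behaviours m' n' \<noteq> ({} :: 'k behaviour set)"
  then obtain S :: "'k behaviour" where S: "S \<in> LTI_behaviours m n" "S \<in> LTI_behaviours m' n'"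
    by blast
  then obtain x y where xy: "(x, y) \<in> S" using LTI_nonempty by fast
  have "m = m'" using LTI_mem(1)[OF S(1) xy] LTI_mem(1)[OF S(2) xy] by (rule traj_disjoint)
  moreover have "n = n'" using LTI_mem(2)[OF S(1) xy] LTI_mem(2)[OF S(2) xy] by (rule traj_disjoint)
  ultimately show False using assms by simp
qed

text \<open>The axioms are checked on elements. Strictness holds because appending vectors is
  associative and unital on the nose; matching intermediate trajectories uses that a join determines
  its parts once the first dimension is fixed.\<close>

lemma prop_category_LTI: "prop_category (LTI :: 'k::field behaviour prop_data)"
proof
  fix m n m' n' :: nat
  assume "(m, n) \<noteq> (m', n')"
  then show "Hom LTI m n \<inter> Hom LTI m' n' = ({} :: 'k behaviour set)"
    using LTI_behaviours_disjoint by simp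
next
  show "Idn LTI n \<in> Hom LTI n (n::nat)" for n
    unfolding behaviour_of_one[symmetric] Hom_LTI
    by (rule LTI_behaviour_of[OF one_carrier_mat one_carrier_mat])
  show "Sym LTI m n \<in> Hom LTI (m + n) (n + m)" for m n
    unfolding behaviour_of_swap[symmetric] Hom_LTI
    by (rule LTI_behaviour_of[OF swap_mat_carrier one_carrier_mat])
next
  fix f f' :: "'k behaviour" and m n m' n' assume "f \<in> Hom LTI m n" "f' \<in> Hom LTI m' n'"
  then show "Tns LTI f f' \<in> Hom LTI (m + m') (n + n')" by (simp add: LTI_Tns)
next
  fix f g :: "'k behaviour" and l m n assume "f \<in> Hom LTI l m" "g \<in> Hom LTI m n"
  then show "Cmp LTI g f \<in> Hom LTI l n" by (simp add: LTI_relcomp Cmp_LTI)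
next
  fix f :: "'k behaviour" and m n assume f: "f \<in> Hom LTI m n"
  then show "Cmp LTI (Idn LTI n) f = f" "Cmp LTI f (Idn LTI m) = f"
    using LTI_mem[of f m n] by (auto simp: Cmp_LTI Idn_LTI_iff)
  obtain z :: "int \<Rightarrow> 'k vec" where z: "z \<in> traj 0" using traj_0_exists by blast
  show "Tns LTI (Idn LTI 0) f = f"
  proof (intro equalityI subrelI)
    show "(x, y) \<in> Tns LTI (Idn LTI 0) f" if "(x, y) \<in> f" for x y
      using Tns_LTI_I[of z z "Idn LTI 0", OF _ that] z by (simp add: Idn_LTI_iff traj_0_unit)
  qed (auto elim!: Tns_LTI_E simp: Idn_LTI_iff traj_0_unit)
  show "Tns LTI f (Idn LTI 0) = f"
  proof (intro equalityI subrelI)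
    show "(x, y) \<in> Tns LTI f (Idn LTI 0)" if "(x, y) \<in> f" for x y
      using Tns_LTI_I[of _ _ _ z z "Idn LTI 0", OF that] z by (simp add: Idn_LTI_iff traj_0_unit)
  qed (auto elim!: Tns_LTI_E simp: Idn_LTI_iff traj_0_unit)
next
  fix f g h :: "'k behaviour"
  show "Cmp LTI (Cmp LTI h g) f = Cmp LTI h (Cmp LTI g f)"
    by (simp add: Cmp_LTI O_assoc)
  show "Tns LTI (Tns LTI f g) h = Tns LTI f (Tns LTI g h)" by (rule Tns_LTI_assoc)
next
  fix m n :: nat
  show "Tns LTI (Idn LTI m) (Idn LTI n) = (Idn LTI (m + n) :: 'k behaviour)"
  proof (intro equalityI subrelI)
    fix w z :: "int \<Rightarrow> 'k vec"
    show "(w, z) \<in> Idn LTI (m + n)" if "(w, z) \<in> Tns LTI (Idn LTI m) (Idn LTI n)"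
      using that by (auto elim!: Tns_LTI_E simp: Idn_LTI_iff traj_join_in_traj)
    assume "(w, z) \<in> Idn LTI (m + n)"
    then obtain x y where "x \<in> traj m" "y \<in> traj n" "w = traj_join x y" "z = traj_join x y"
      by (auto simp: Idn_LTI_iff elim: traj_splitE)
    then show "(w, z) \<in> Tns LTI (Idn LTI m) (Idn LTI n)"
      by (auto simp: Idn_LTI_iff intro!: Tns_LTI_I)
  qed
  show "Cmp LTI (Sym LTI n m) (Sym LTI m n) = (Idn LTI (m + n) :: 'k behaviour)"
  proof (intro equalityI subrelI)
    fix w z :: "int \<Rightarrow> 'k vec"
    {
      assume "(w, z) \<in> Cmp LTI (Sym LTI n m) (Sym LTI m n)"
      then show "(w, z) \<in> Idn LTI (m + n)"
        by (auto simp: Cmp_LTI Idn_LTI_iff traj_join_inject traj_join_in_traj elim!: Sym_LTI_E)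
    next
      assume "(w, z) \<in> Idn LTI (m + n)"
      then obtain x y where "x \<in> traj m" "y \<in> traj n" "w = traj_join x y" "z = traj_join x y"
        by (auto simp: Idn_LTI_iff elim: traj_splitE)
      then show "(w, z) \<in> Cmp LTI (Sym LTI n m) (Sym LTI m n)"
        by (auto simp: Cmp_LTI intro!: relcompI[of _ "traj_join y x"] Sym_LTI_I)
    }
  qed
next
  fix f g f' g' :: "'k behaviour" and l m n l' m' n'
  assume fg: "f \<in> Hom LTI l m" "g \<in> Hom LTI m n" "f' \<in> Hom LTI l' m'" "g' \<in> Hom LTI m' n'"
  show "Tns LTI (Cmp LTI g f) (Cmp LTI g' f') = Cmp LTI (Tns LTI g g') (Tns LTI f f')"
  proof (intro equalityI subrelI)
    fix w z
    {
      assume "(w, z) \<in> Tns LTI (Cmp LTI g f) (Cmp LTI g' f')"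
      then show "(w, z) \<in> Cmp LTI (Tns LTI g g') (Tns LTI f f')"
        by (auto simp: Cmp_LTI elim!: Tns_LTI_E intro: Tns_LTI_I)
    next
      assume "(w, z) \<in> Cmp LTI (Tns LTI g g') (Tns LTI f f')"
      then obtain v where wv: "(w, v) \<in> Tns LTI f f'" and vz: "(v, z) \<in> Tns LTI g g'"
        by (auto simp: Cmp_LTI)
      obtain x x' y y' where x: "w = traj_join x x'" "v = traj_join y y'" "(x, y) \<in> f" "(x', y') \<in> f'"
        by (rule Tns_LTI_E[OF wv])
      obtain u u' r r' where u: "v = traj_join u u'" "z = traj_join r r'" "(u, r) \<in> g" "(u', r') \<in> g'"
        by (rule Tns_LTI_E[OF vz])
      have "y \<in> traj m" "u \<in> traj m" using x u fg LTI_mem[of f l m] LTI_mem[of g m n] by auto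
      then have "y = u \<and> y' = u'"
        using traj_join_inject[of y m u y' u'] x(2) u(1) by metis
      then show "(w, z) \<in> Tns LTI (Cmp LTI g f) (Cmp LTI g' f')"
        using x u by (auto simp: Cmp_LTI intro: Tns_LTI_I)
    }
  qed
next
  fix f f' :: "'k behaviour" and m n m' n'
  assume f: "f \<in> Hom LTI m n" "f' \<in> Hom LTI m' n'"
  show "Cmp LTI (Sym LTI n n') (Tns LTI f f') = Cmp LTI (Tns LTI f' f) (Sym LTI m m')"
  proof (intro equalityI subrelI)
    fix w z
    {
      assume "(w, z) \<in> Cmp LTI (Sym LTI n n') (Tns LTI f f')"
      then obtain v where wv: "(w, v) \<in> Tns LTI f f'" and vz: "(v, z) \<in> Sym LTI n n'"
        by (auto simp: Cmp_LTI)
      obtain x x' y y' where x: "w = traj_join x x'" "v = traj_join y y'" "(x, y) \<in> f" "(x', y') \<in> f'"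
        by (rule Tns_LTI_E[OF wv])
      obtain u u' where u: "v = traj_join u u'" "z = traj_join u' u" "u \<in> traj n" "u' \<in> traj n'"
        by (rule Sym_LTI_E[OF vz])
      have mem: "x \<in> traj m" "x' \<in> traj m'" "y \<in> traj n"
        using x f LTI_mem[of f m n] LTI_mem[of f' m' n'] by auto
      then have "y = u \<and> y' = u'"
        using traj_join_inject[of y n u y' u'] x(2) u(1,3) by metis
      then show "(w, z) \<in> Cmp LTI (Tns LTI f' f) (Sym LTI m m')"
        unfolding Cmp_LTI using x u mem
        by (intro relcompI[of _ "traj_join x' x"]) (auto intro: Tns_LTI_I Sym_LTI_I)
    next
      assume "(w, z) \<in> Cmp LTI (Tns LTI f' f) (Sym LTI m m')"
      then obtain v where wv: "(w, v) \<in> Sym LTI m m'" and vz: "(v, z) \<in> Tns LTI f' f"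
        by (auto simp: Cmp_LTI)
      obtain x x' y y' where x: "v = traj_join x' x" "z = traj_join y' y" "(x', y') \<in> f'" "(x, y) \<in> f"
        by (rule Tns_LTI_E[OF vz])
      obtain u u' where u: "w = traj_join u u'" "v = traj_join u' u" "u \<in> traj m" "u' \<in> traj m'"
        by (rule Sym_LTI_E[OF wv])
      have mem: "x' \<in> traj m'" "y \<in> traj n" "y' \<in> traj n'"
        using x f LTI_mem[of f m n] LTI_mem[of f' m' n'] by auto
      then have "x' = u' \<and> x = u"
        using traj_join_inject[of x' m' u' x u] x(1) u(2,4) by metis
      then show "(w, z) \<in> Cmp LTI (Sym LTI n n') (Tns LTI f f')"
        unfolding Cmp_LTI using x u mem
        by (intro relcompI[of _ "traj_join y y'"]) (auto intro: Tns_LTI_I Sym_LTI_I)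
    }
  qed
next
  fix l m n :: nat
  show "Sym LTI (l + m) n =
      (Cmp LTI (Tns LTI (Sym LTI l n) (Idn LTI m)) (Tns LTI (Idn LTI l) (Sym LTI m n)) :: 'k behaviour)"
  proof (intro equalityI subrelI)
    fix w z :: "int \<Rightarrow> 'k vec"
    {
      assume "(w, z) \<in> Sym LTI (l + m) n"
      then obtain x y c where xyc: "x \<in> traj l" "y \<in> traj m" "c \<in> traj n"
        and wz: "w = traj_join (traj_join x y) c" "z = traj_join c (traj_join x y)"
        by (auto elim!: Sym_LTI_E elim: traj_splitE)
      have "(w, traj_join x (traj_join c y)) \<in> Tns LTI (Idn LTI l) (Sym LTI m n)"
        unfolding wz traj_join_assoc using xyc by (intro Tns_LTI_I Sym_LTI_I) (simp_all add: Idn_LTI_iff)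
      moreover have "(traj_join x (traj_join c y), z) \<in> Tns LTI (Sym LTI l n) (Idn LTI m)"
        unfolding wz traj_join_assoc[symmetric] using xyc
        by (intro Tns_LTI_I Sym_LTI_I) (simp_all add: Idn_LTI_iff)
      ultimately show "(w, z) \<in>
          Cmp LTI (Tns LTI (Sym LTI l n) (Idn LTI m)) (Tns LTI (Idn LTI l) (Sym LTI m n))"
        unfolding Cmp_LTI by blast
    next
      assume "(w, z) \<in>
          Cmp LTI (Tns LTI (Sym LTI l n) (Idn LTI m)) (Tns LTI (Idn LTI l) (Sym LTI m n))"
      then obtain v where wv: "(w, v) \<in> Tns LTI (Idn LTI l) (Sym LTI m n)"
        and vz: "(v, z) \<in> Tns LTI (Sym LTI l n) (Idn LTI m)"
        by (auto simp: Cmp_LTI)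
      from wv obtain x y c where 1: "x \<in> traj l" "y \<in> traj m" "c \<in> traj n"
        "w = traj_join x (traj_join y c)" "v = traj_join x (traj_join c y)"
        by (auto elim!: Tns_LTI_E Sym_LTI_E simp: Idn_LTI_iff)
      from vz obtain x' y' c' where 2: "x' \<in> traj l" "y' \<in> traj m" "c' \<in> traj n"
        "v = traj_join (traj_join x' c') y'" "z = traj_join (traj_join c' x') y'"
        by (auto elim!: Tns_LTI_E Sym_LTI_E simp: Idn_LTI_iff)
      have "traj_join x (traj_join c y) = traj_join x' (traj_join c' y')"
        using 1(5) 2(4) by (simp add: traj_join_assoc)
      then have "x = x' \<and> c = c' \<and> y = y'"
        using 1 2 by (simp add: traj_join_inject[of _ l] traj_join_inject[of _ n])
      then show "(w, z) \<in> Sym LTI (l + m) n"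
        using Sym_LTI_I[OF traj_join_in_traj[OF 1(1,2)] 1(3)] 1 2 by (simp add: traj_join_assoc)
    }
  qed
qed

section \<open>Corelations and behaviours\<close>

text \<open>\<open>P\<close> enters as bare data. Since \<open>G\<close> hits every arrow of
  \<open>P\<close>, respects the operations and is injective on hom-sets by \<open>F\<close>, each
  axiom of \<open>Q\<close> carries over. Associativity of corelation composition is obtained this
  way, without comparing iterated pushouts.\<close>

lemma prop_isomorphism_transport:
  fixes P :: "'a prop_data" and Q :: "'b prop_data" and G F
  assumes Q: "prop_category Q"
    and Hom: "\<And>m n. Hom P m n = G m n ` Hom Q m n"
    and disj: "\<And>m n m' n'. (m, n) \<noteq> (m', n') \<Longrightarrow> Hom P m n \<inter> Hom P m' n' = {}"
    and FG: "\<And>m n f. f \<in> Hom Q m n \<Longrightarrow> F m n (G m n f) = f"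
    and Cmp: "\<And>l m n f g. f \<in> Hom Q l m \<Longrightarrow> g \<in> Hom Q m n \<Longrightarrow>
      Cmp P (G m n g) (G l m f) = G l n (Cmp Q g f)"
    and Idn: "\<And>n. Idn P n = G n n (Idn Q n)"
    and Tns: "\<And>m n m' n' f f'. f \<in> Hom Q m n \<Longrightarrow> f' \<in> Hom Q m' n' \<Longrightarrow>
      Tns P (G m n f) (G m' n' f') = G (m + m') (n + n') (Tns Q f f')"
    and Sym: "\<And>m n. Sym P m n = G (m + n) (n + m) (Sym Q m n)"
  shows "prop_isomorphism P Q F"
proof -
  interpret Q: prop_category Q by fact
  have GH: "G m n f \<in> Hom P m n" if "f \<in> Hom Q m n" for m n f using that Hom by blast
  have HG: "\<exists>f0\<in>Hom Q m n. f = G m n f0" if "f \<in> Hom P m n" for m n f using that Hom by blast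
  note closed = Q.Cmp_in_Hom Q.Idn_in_Hom Q.Tns_in_Hom Q.Sym_in_Hom
  have P: "prop_category P"
  proof
    show "Idn P n \<in> Hom P n n" for n using closed by (simp add: Idn GH)
    show "Sym P m n \<in> Hom P (m + n) (n + m)" for m n using closed by (simp add: Sym GH)
    show "Tns P (Idn P m) (Idn P n) = Idn P (m + n)" for m n
      using closed by (simp add: Idn Tns Q.Tns_Idn)
    show "Cmp P (Sym P n m) (Sym P m n) = Idn P (m + n)" for m n
      using closed by (simp add: Idn Sym Cmp Q.Sym_Sym)
    show "Sym P (l + m) n =
      Cmp P (Tns P (Sym P l n) (Idn P m)) (Tns P (Idn P l) (Sym P m n))" for l m n
    proof -
      \<comment> \<open>\<open>G\<close> carries object indices, so the two bracketings of each sum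
        of objects must be identified before compatibility with composition applies.\<close>
      have "Tns Q (Idn Q l) (Sym Q m n) \<in> Hom Q (l + m + n) (l + n + m)"
        using Q.Tns_in_Hom[OF Q.Idn_in_Hom[of l] Q.Sym_in_Hom[of m n]] by (simp add: add.assoc)
      moreover have "Tns Q (Sym Q l n) (Idn Q m) \<in> Hom Q (l + n + m) (n + (l + m))"
        using Q.Tns_in_Hom[OF Q.Sym_in_Hom[of l n] Q.Idn_in_Hom[of m]] by (simp add: add.assoc)
      moreover have "Tns P (Idn P l) (Sym P m n) =
          G (l + m + n) (l + n + m) (Tns Q (Idn Q l) (Sym Q m n))"
        unfolding Idn Sym Tns[OF Q.Idn_in_Hom Q.Sym_in_Hom] by (simp add: add.assoc)
      moreover have "Tns P (Sym P l n) (Idn P m) =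
          G (l + n + m) (n + (l + m)) (Tns Q (Sym Q l n) (Idn Q m))"
        unfolding Idn Sym Tns[OF Q.Sym_in_Hom Q.Idn_in_Hom] by (simp add: add.assoc)
      ultimately show ?thesis using Sym[of "l + m" n] Q.Sym_hexagon[of l m n] Cmp by simp
    qed
  next
    fix f g l m n assume "f \<in> Hom P l m" "g \<in> Hom P m n"
    then show "Cmp P g f \<in> Hom P l n"
      by (auto dest!: HG intro!: GH closed simp: Cmp)
  next
    fix f g h k l m n assume "f \<in> Hom P k l" "g \<in> Hom P l m" "h \<in> Hom P m n"
    then obtain f0 g0 h0 where *: "f0 \<in> Hom Q k l" "g0 \<in> Hom Q l m" "h0 \<in> Hom Q m n"
      "f = G k l f0" "g = G l m g0" "h = G m n h0" using HG by metis
    then have "Cmp Q g0 f0 \<in> Hom Q k m" "Cmp Q h0 g0 \<in> Hom Q l n" by (auto intro: closed)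
    then show "Cmp P (Cmp P h g) f = Cmp P h (Cmp P g f)"
      using * by (simp add: Cmp Q.Cmp_assoc)
  next
    fix f m n assume "f \<in> Hom P m n"
    then obtain f0 where *: "f0 \<in> Hom Q m n" "f = G m n f0" using HG by metis
    show "Cmp P (Idn P n) f = f" "Cmp P f (Idn P m) = f"
      using * closed(2) by (simp_all add: Idn Cmp Q.Cmp_Idn_left Q.Cmp_Idn_right)
    show "Tns P (Idn P 0) f = f" "Tns P f (Idn P 0) = f"
      using * Tns[OF Q.Idn_in_Hom[of 0] *(1)] Tns[OF *(1) Q.Idn_in_Hom[of 0]]
      by (simp_all add: Idn Q.Tns_unit_left Q.Tns_unit_right)
  next
    fix f f' m n m' n' assume "f \<in> Hom P m n" "f' \<in> Hom P m' n'"
    then obtain f0 f0' where *: "f0 \<in> Hom Q m n" "f0' \<in> Hom Q m' n'"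
      "f = G m n f0" "f' = G m' n' f0'" using HG by metis
    then show "Tns P f f' \<in> Hom P (m + m') (n + n')" by (simp add: Tns GH closed)
    show "Cmp P (Sym P n n') (Tns P f f') = Cmp P (Tns P f' f) (Sym P m m')"
      using * by (simp add: Sym Tns Cmp[OF Q.Tns_in_Hom Q.Sym_in_Hom]
          Cmp[OF Q.Sym_in_Hom Q.Tns_in_Hom] Q.Sym_natural)
  next
    fix f g f' g' l m n l' m' n'
    assume "f \<in> Hom P l m" "g \<in> Hom P m n" "f' \<in> Hom P l' m'" "g' \<in> Hom P m' n'"
    then obtain f0 g0 f0' g0' where *: "f0 \<in> Hom Q l m" "g0 \<in> Hom Q m n" "f0' \<in> Hom Q l' m'"
      "g0' \<in> Hom Q m' n'" "f = G l m f0" "g = G m n g0" "f' = G l' m' f0'" "g' = G m' n' g0'"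
      using HG by metis
    show "Tns P (Cmp P g f) (Cmp P g' f') = Cmp P (Tns P g g') (Tns P f f')"
      using * by (simp add: Cmp Tns[OF Q.Cmp_in_Hom Q.Cmp_in_Hom] Tns
          Cmp[OF Q.Tns_in_Hom Q.Tns_in_Hom] Q.Tns_Cmp)
  next
    fix f f' f'' m n m' n' m'' n''
    assume "f \<in> Hom P m n" "f' \<in> Hom P m' n'" "f'' \<in> Hom P m'' n''"
    then obtain f0 f0' f0'' where *: "f0 \<in> Hom Q m n" "f0' \<in> Hom Q m' n'" "f0'' \<in> Hom Q m'' n''"
      "f = G m n f0" "f' = G m' n' f0'" "f'' = G m'' n'' f0''" using HG by metis
    show "Tns P (Tns P f f') f'' = Tns P f (Tns P f' f'')"
      using * by (simp add: Tns Tns[OF Q.Tns_in_Hom] Tns[OF _ Q.Tns_in_Hom] Q.Tns_assoc add.assoc)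
  qed (rule disj)
  have "prop_morphism P Q F"
  proof (intro prop_morphism.intro prop_morphism_axioms.intro P Q)
    fix f m n assume "f \<in> Hom P m n"
    then show "F m n f \<in> Hom Q m n" using HG FG by metis
  next
    fix f g l m n assume "f \<in> Hom P l m" "g \<in> Hom P m n"
    then obtain f0 g0 where *: "f0 \<in> Hom Q l m" "g0 \<in> Hom Q m n"
      "f = G l m f0" "g = G m n g0" using HG by metis
    then show "F l n (Cmp P g f) = Cmp Q (F m n g) (F l m f)"
      by (simp add: Cmp FG closed(1)[OF *(1,2)])
  next
    fix f f' m n m' n' assume "f \<in> Hom P m n" "f' \<in> Hom P m' n'"
    then obtain f0 f0' where *: "f0 \<in> Hom Q m n" "f0' \<in> Hom Q m' n'"
      "f = G m n f0" "f' = G m' n' f0'" using HG by metis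
    then show "F (m + m') (n + n') (Tns P f f') = Tns Q (F m n f) (F m' n' f')"
      by (simp add: Tns FG closed(3)[OF *(1,2)])
  qed (simp_all add: Idn Sym FG closed)
  moreover have "prop_morphism Q P G"
    by (intro prop_morphism.intro prop_morphism_axioms.intro P Q)
      (simp_all add: Cmp Tns Idn Sym GH)
  moreover have "\<forall>m n. \<forall>f\<in>Hom P m n. G m n (F m n f) = f" using HG FG by metis
  ultimately show ?thesis unfolding prop_isomorphism_def using FG by blast
qed

section \<open>Cospans classified by their behaviours\<close>

lemma Mat_simps:
  "Hom Mat m n = carrier_mat n m" "Cmp Mat B A = B * A" "Idn Mat n = 1\<^sub>m n"
  by (simp_all add: Mat_def)

lemma behaviour_of_mult:
  assumes X: "X \<in> carrier_mat e d" and A: "A \<in> carrier_mat d m" and B: "B \<in> carrier_mat d n"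
  shows "behaviour_of A B \<subseteq> behaviour_of (X * A) (X * B)"
proof (rule subrelI)
  fix x y assume "(x, y) \<in> behaviour_of A B"
  then show "(x, y) \<in> behaviour_of (X * A) (X * B)"
    unfolding behaviour_of_iff[OF A B] behaviour_of_iff[OF mult_carrier_mat[OF X A] mult_carrier_mat[OF X B]]
    by (simp add: theta_mult[OF X A] theta_mult[OF X B])
qed

text \<open>Converse to \<open>behaviour_of_mult\<close>: inclusions of behaviours are exactly what
  matrices mapping one cospan to the other induce. It comes from inclusion of kernels applied to
  \<open>[A -B]\<close>, the sign cancelling in the second block.\<close>

lemma behaviour_of_subset_factor:
  assumes A: "A \<in> carrier_mat d m" and B: "B \<in> carrier_mat d n"
    and A': "A' \<in> carrier_mat d' m" and B': "B' \<in> carrier_mat d' n"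
    and sub: "behaviour_of A B \<subseteq> behaviour_of A' B'"
  shows "\<exists>X\<in>carrier_mat d' d. A' = X * A \<and> B' = X * B"
proof -
  have "ker_theta (copair A (- B)) \<subseteq> ker_theta (copair A' (- B'))"
    unfolding traj_join_behaviour_of[OF A B, symmetric] traj_join_behaviour_of[OF A' B', symmetric]
    using sub by (rule image_mono)
  then obtain X where X: "X \<in> carrier_mat d' d" and eq: "copair A' (- B') = X * copair A (- B)"
    using ker_theta_subset_imp_factor[OF copair_carrier[OF A uminus_carrier_mat[OF B]]
        copair_carrier[OF A' uminus_carrier_mat[OF B']]] by blast
  have "copair A' (- B') = copair (X * A) (- (X * B))"
    using X A B by (simp add: eq mult_copair[OF A uminus_carrier_mat[OF B] X])
  moreover have "X * A \<in> carrier_mat d' m" "- (X * B) \<in> carrier_mat d' n" using X A B by auto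
  ultimately have "A' = X * A" "- B' = - (X * B)"
    using copair_inject[of A' d' m "- B'" n "X * A" "- (X * B)"] A' B' by auto
  then show ?thesis using X by auto
qed

text \<open>An epic corelation is determined up to isomorphism by its behaviour, so isomorphism classes
  are fibres of \<^const>\<open>behaviour_of\<close>.\<close>

definition corel_of :: "nat \<Rightarrow> nat \<Rightarrow> 'k::field behaviour \<Rightarrow> 'k cospan set" where
  "corel_of m n S = {(A, B). \<exists>d. jointly_epic m n d A B \<and> behaviour_of A B = S}"

text \<open>\<open>Y * X\<close> and the identity agree on both legs, so joint epicness identifies
  them. This yields both the isomorphism between representatives and the splitting of the mono in a
  factorisation.\<close>

lemma jointly_epic_left_inverse:
  assumes je: "jointly_epic m n d A B" and Y: "Y \<in> carrier_mat d e" and X: "X \<in> carrier_mat e d"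
    and eq: "A = Y * (X * A)" "B = Y * (X * B)"
  shows "Y * X = 1\<^sub>m d"
proof (rule jointly_epic_cancel[OF je])
  note AB = jointly_epic_carrier[OF je]
  show "Y * X * A = 1\<^sub>m d * A" using eq(1) AB(1) assoc_mult_mat[OF Y X AB(1)] by simp
  show "Y * X * B = 1\<^sub>m d * B" using eq(2) AB(2) assoc_mult_mat[OF Y X AB(2)] by simp
qed (use X Y in auto)

text \<open>An isomorphism can be undone, so it preserves joint epicness and the behaviour.
  Conversely, equal behaviours give factorisations in both directions, and joint epicness of each
  cospan makes the two factors mutually inverse.\<close>

lemma corel_class_eq:
  assumes je: "jointly_epic m n d A B"
  shows "corel_class A B = corel_of m n (behaviour_of A B)"
proof (intro equalityI subrelI)
  note AB = jointly_epic_carrier[OF je]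
  fix A' B' assume "(A', B') \<in> corel_class A B"
  then obtain d0 d' U V where c: "A \<in> carrier_mat d0 (dim_col A)" and U: "U \<in> carrier_mat d' d0"
    and V: "V \<in> carrier_mat d0 d'" and VU: "V * U = 1\<^sub>m d0" and UV: "U * V = 1\<^sub>m d'"
    and A': "A' = U * A" and B': "B' = U * B"
    by (auto simp: corel_class_def cospan_iso_def iso_arrow_def Mat_def)
  have "d0 = d" using c AB(1) by auto
  note U = U[unfolded this] and V = V[unfolded this] and VU = VU[unfolded this]
  have carr: "A' \<in> carrier_mat d' m" "B' \<in> carrier_mat d' n" using U AB by (simp_all add: A' B')
  have undo: "V * A' = A" "V * B' = B"
    using VU AB assoc_mult_mat[OF V U AB(1)] assoc_mult_mat[OF V U AB(2)] by (simp_all add: A' B')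
  have "g = 0\<^sub>m p d'" if g: "g \<in> carrier_mat p d'" and 0: "g * A' = 0\<^sub>m p m" "g * B' = 0\<^sub>m p n" for p g
  proof -
    have "g * U * A = 0\<^sub>m p m" "g * U * B = 0\<^sub>m p n"
      using 0 assoc_mult_mat[OF g U AB(1)] assoc_mult_mat[OF g U AB(2)] by (simp_all add: A' B')
    then have "g * U = 0\<^sub>m p d" using je g U unfolding jointly_epic_iff by (meson mult_carrier_mat)
    then have "g * U * V = 0\<^sub>m p d'" using V by simp
    then show ?thesis using assoc_mult_mat[OF g U V] UV g by simp
  qed
  then have "jointly_epic m n d' A' B'" using carr by (simp add: jointly_epic_iff)
  moreover have "behaviour_of A' B' = behaviour_of A B"
    using behaviour_of_mult[OF U AB] behaviour_of_mult[OF V carr]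
    unfolding undo by (auto simp: A' B')
  ultimately show "(A', B') \<in> corel_of m n (behaviour_of A B)" by (auto simp: corel_of_def)
next
  note AB = jointly_epic_carrier[OF je]
  fix A' B' assume "(A', B') \<in> corel_of m n (behaviour_of A B)"
  then obtain d' where je': "jointly_epic m n d' A' B'" and eq: "behaviour_of A' B' = behaviour_of A B"
    by (auto simp: corel_of_def)
  note AB' = jointly_epic_carrier[OF je']
  obtain X where X: "X \<in> carrier_mat d' d" "A' = X * A" "B' = X * B"
    using behaviour_of_subset_factor[OF AB AB'] eq by auto
  obtain Y where Y: "Y \<in> carrier_mat d d'" "A = Y * A'" "B = Y * B'"
    using behaviour_of_subset_factor[OF AB' AB] eq by auto
  have "Y * X = 1\<^sub>m d" using X Y by (intro jointly_epic_left_inverse[OF je Y(1) X(1)]) auto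
  moreover have "X * Y = 1\<^sub>m d'" using X Y by (intro jointly_epic_left_inverse[OF je' X(1) Y(1)]) auto
  ultimately have "A \<in> Hom Mat m d \<and> B \<in> Hom Mat n d \<and> iso_arrow Mat d d' X \<and>
      A' = Cmp Mat X A \<and> B' = Cmp Mat X B"
    using X Y AB by (auto simp: iso_arrow_def Mat_simps)
  then show "(A', B') \<in> corel_class A B"
    unfolding corel_class_def cospan_iso_def mem_Collect_eq prod.case by (intro exI)
qed

lemma corel_of_nonempty:
  assumes "S \<in> LTI_behaviours m n"
  shows "corel_of m n S \<noteq> {}"
proof -
  obtain d A B where "jointly_epic m n d A B" "behaviour_of A B = S"
    by (rule LTI_behaviour_representation[OF assms])
  then have "(A, B) \<in> corel_of m n S" by (auto simp: corel_of_def)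
  then show ?thesis by blast
qed

section \<open>Operations on corelations in terms of behaviours\<close>

lemma Hom_Corel_Mat:
  "Hom (Corel_Mat :: 'k::field cospan set prop_data) m n = corel_of m n ` LTI_behaviours m n"
proof
  show "Hom Corel_Mat m n \<subseteq> (corel_of m n ` LTI_behaviours m n :: 'k cospan set set)"
  proof
    fix X :: "'k cospan set" assume "X \<in> Hom Corel_Mat m n"
    then obtain d A B where je: "jointly_epic m n d A B" and X: "X = corel_class A B"
      by (auto simp: Corel_Mat_def)
    show "X \<in> corel_of m n ` LTI_behaviours m n"
      unfolding X corel_class_eq[OF je]
      by (intro imageI LTI_behaviour_of[OF jointly_epic_carrier[OF je]])
  qed
  show "corel_of m n ` LTI_behaviours m n \<subseteq> (Hom Corel_Mat m n :: 'k cospan set set)"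
  proof (rule image_subsetI)
    fix S :: "'k behaviour" assume "S \<in> LTI_behaviours m n"
    then obtain d A B where "jointly_epic m n d A B" "behaviour_of A B = S"
      by (rule LTI_behaviour_representation)
    then have "corel_of m n S = corel_class A B" using corel_class_eq by blast
    then show "corel_of m n S \<in> Hom Corel_Mat m n"
      using \<open>jointly_epic m n d A B\<close> by (auto simp: Corel_Mat_def)
  qed
qed

lemma corel_of_in_cospans:
  "(A, B) \<in> corel_of m n S \<Longrightarrow> dim_col A = m \<and> dim_col B = n"
  using jointly_epic_carrier[of m n _ A B] by (auto simp: corel_of_def)

lemma Hom_Corel_Mat_disjoint:
  assumes "(m, n) \<noteq> (m', n')"
  shows "Hom Corel_Mat m n \<inter> Hom Corel_Mat m' n' = ({} :: 'k::field cospan set set)"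
proof (rule ccontr)
  assume "Hom Corel_Mat m n \<inter> Hom Corel_Mat m' n' \<noteq> ({} :: 'k cospan set set)"
  then obtain S S' :: "'k behaviour" where "S \<in> LTI_behaviours m n"
    and eq: "corel_of m n S = corel_of m' n' S'"
    unfolding Hom_Corel_Mat by blast
  then obtain A B where "(A, B) \<in> corel_of m n S" using corel_of_nonempty by fast
  then show False
    using eq corel_of_in_cospans[of A B m n S] corel_of_in_cospans[of A B m' n' S'] assms by auto
qed

text \<open>The pushout cospan has the composite behaviour, and dropping \<open>M\<close> keeps it
  because \<open>M\<close> has a left inverse. Splitness matters: \<open>s - 1\<close> is mono, yet
  multiplying by it enlarges kernels.\<close>

lemma corel_composite_behaviour:
  assumes comp: "corel_composite (A, B) (C, D) (A', B')"
    and AB: "jointly_epic m n a A B" and CD: "jointly_epic n l b C D"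
  shows "(A', B') \<in> corel_of m l (behaviour_of A B O behaviour_of C D)"
proof -
  note carr = jointly_epic_carrier[OF AB] jointly_epic_carrier[OF CD]
  obtain m0 n0 l0 a0 b0 e d P Q M where 0: "A \<in> carrier_mat a0 m0" "B \<in> carrier_mat a0 n0"
    "C \<in> carrier_mat b0 n0" "D \<in> carrier_mat b0 l0"
    and po: "is_pushout Mat n0 a0 b0 e B C P Q" and je: "jointly_epic m0 l0 d A' B'"
    and sm: "split_mono Mat d e M" and eq: "M * copair A' B' = copair (P * A) (Q * D)"
    using comp by (auto simp: corel_composite_def Mat_def)
  have dims: "m0 = m" "n0 = n" "l0 = l" "a0 = a" "b0 = b" using 0 carr by auto
  note po = po[unfolded dims] and je = je[unfolded dims]
  note AB' = jointly_epic_carrier[OF je]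
  have P: "P \<in> carrier_mat e a" and Q: "Q \<in> carrier_mat e b"
    using po by (simp_all add: is_pushout_def Mat_def)
  obtain R where M: "M \<in> carrier_mat e d" and R: "R \<in> carrier_mat d e" and RM: "R * M = 1\<^sub>m d"
    using sm by (auto simp: split_mono_def Mat_def)
  have PA: "M * A' = P * A" and QD: "M * B' = Q * D"
    using eq copair_inject[OF mult_carrier_mat[OF M AB'(1)] mult_carrier_mat[OF M AB'(2)]
        mult_carrier_mat[OF P carr(1)] mult_carrier_mat[OF Q carr(4)]]
    by (simp_all add: mult_copair[OF AB' M])
  have undo: "R * (M * A') = A'" "R * (M * B') = B'"
    using RM AB' assoc_mult_mat[OF R M AB'(1)] assoc_mult_mat[OF R M AB'(2)] by simp_all
  have "behaviour_of A' B' = behaviour_of (M * A') (M * B')"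
    using behaviour_of_mult[OF M AB']
      behaviour_of_mult[OF R mult_carrier_mat[OF M AB'(1)] mult_carrier_mat[OF M AB'(2)]]
    unfolding undo by (rule equalityI)
  also have "\<dots> = behaviour_of A B O behaviour_of C D"
    unfolding PA QD by (rule behaviour_of_pushout[OF carr(1,4) po])
  finally show ?thesis using je by (auto simp: corel_of_def)
qed

text \<open>Any jointly epic cospan with the composite behaviour is an outcome: comparing it with a
  pushout cospan of the same behaviour gives \<open>M\<close> and \<open>R\<close>, and joint
  epicness makes \<open>R\<close> a left inverse of \<open>M\<close>. The required factorisation is
  thus read off from behaviours.\<close>

lemma corel_composite_exists:
  assumes je: "jointly_epic m l d A' B'"
    and AB: "jointly_epic m n a A B" and CD: "jointly_epic n l b C D"
    and beh: "behaviour_of A' B' = behaviour_of A B O behaviour_of C D"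
  shows "corel_composite (A, B) (C, D) (A', B')"
proof -
  note carr = jointly_epic_carrier[OF AB] jointly_epic_carrier[OF CD]
  note AB' = jointly_epic_carrier[OF je]
  obtain e P Q where po: "is_pushout Mat n a b e B C P Q"
    using pushout_exists[OF carr(2,3)] by blast
  then have P: "P \<in> carrier_mat e a" and Q: "Q \<in> carrier_mat e b"
    by (simp_all add: is_pushout_def Mat_def)
  note PA = mult_carrier_mat[OF P carr(1)] and QD = mult_carrier_mat[OF Q carr(4)]
  have eq: "behaviour_of A' B' = behaviour_of (P * A) (Q * D)"
    using beh behaviour_of_pushout[OF carr(1,4) po] by simp
  obtain M where M: "M \<in> carrier_mat e d" "P * A = M * A'" "Q * D = M * B'"
    using behaviour_of_subset_factor[OF AB' PA QD] eq by auto
  obtain R where R: "R \<in> carrier_mat d e" "A' = R * (P * A)" "B' = R * (Q * D)"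
    using behaviour_of_subset_factor[OF PA QD AB'] eq by auto
  have "R * M = 1\<^sub>m d"
    using R(2,3) unfolding M(2,3) by (rule jointly_epic_left_inverse[OF je R(1) M(1)])
  then have sm: "split_mono Mat d e M" using M(1) R(1) by (auto simp: split_mono_def Mat_def)
  have eqM: "M * copair A' B' = copair (P * A) (Q * D)"
    unfolding mult_copair[OF AB' M(1)] M(2,3) ..
  have "A \<in> Hom Mat m a \<and> B \<in> Hom Mat n a \<and> C \<in> Hom Mat n b \<and> D \<in> Hom Mat l b \<and>
      is_pushout Mat n a b e B C P Q \<and> jointly_epic m l d A' B' \<and> split_mono Mat d e M \<and>
      Cmp Mat M (copair A' B') = copair (Cmp Mat P A) (Cmp Mat Q D)"
    using carr po je sm eqM by (simp add: Mat_simps)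
  then show ?thesis unfolding corel_composite_def prod.case by (intro exI)
qed

text \<open>All choices of representatives, pushouts and factorisations lead to the same behaviour,
  and every cospan with that behaviour is reached. The set of outcomes is therefore one whole
  class.\<close>

lemma Cmp_Corel_Mat:
  assumes S: "S \<in> LTI_behaviours l m" and T: "T \<in> LTI_behaviours m n"
  shows "Cmp Corel_Mat (corel_of m n T) (corel_of l m S) = corel_of l n (Cmp LTI T S)"
proof (intro equalityI subrelI)
  fix A' B' assume "(A', B') \<in> Cmp Corel_Mat (corel_of m n T) (corel_of l m S)"
  then obtain A B C D where "(A, B) \<in> corel_of l m S" "(C, D) \<in> corel_of m n T"
    and comp: "corel_composite (A, B) (C, D) (A', B')"
    by (auto simp: Corel_Mat_def)
  then obtain a b where AB: "jointly_epic l m a A B" "behaviour_of A B = S"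
    and CD: "jointly_epic m n b C D" "behaviour_of C D = T"
    by (auto simp: corel_of_def)
  show "(A', B') \<in> corel_of l n (Cmp LTI T S)"
    using corel_composite_behaviour[OF comp AB(1) CD(1)] by (simp add: AB(2) CD(2) Cmp_LTI)
next
  fix A' B' assume "(A', B') \<in> corel_of l n (Cmp LTI T S)"
  then obtain d where d: "jointly_epic l n d A' B'" "behaviour_of A' B' = S O T"
    by (auto simp: corel_of_def Cmp_LTI)
  obtain a A B where AB: "jointly_epic l m a A B" "behaviour_of A B = S"
    by (rule LTI_behaviour_representation[OF S])
  obtain b C D where CD: "jointly_epic m n b C D" "behaviour_of C D = T"
    by (rule LTI_behaviour_representation[OF T])
  have "corel_composite (A, B) (C, D) (A', B')"
    using d AB CD by (intro corel_composite_exists) auto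
  moreover have "(A, B) \<in> corel_of l m S" "(C, D) \<in> corel_of m n T"
    using AB CD by (auto simp: corel_of_def)
  ultimately show "(A', B') \<in> Cmp Corel_Mat (corel_of m n T) (corel_of l m S)"
    unfolding Corel_Mat_def prop_data.simps by blast
qed

text \<open>A test matrix on the sum splits by columns into one test matrix for each summand, and
  the block-diagonal legs test them separately.\<close>

lemma jointly_epic_block_diag:
  assumes AB: "jointly_epic m n d A B" and CD: "jointly_epic m' n' d' C D"
  shows "jointly_epic (m + m') (n + n') (d + d') (block_diag A C) (block_diag B D)"
  unfolding jointly_epic_iff
proof (intro conjI allI ballI impI)
  note carr = jointly_epic_carrier[OF AB] jointly_epic_carrier[OF CD]
  fix p g
  assume g: "g \<in> carrier_mat p (d + d')" and 0: "g * block_diag A C = 0\<^sub>m p (m + m')"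
    "g * block_diag B D = 0\<^sub>m p (n + n')"
  obtain h h' where h: "h \<in> carrier_mat p d" and h': "h' \<in> carrier_mat p d'" and gh: "g = copair h h'"
    by (rule copair_splitE[OF g])
  have "h * A = 0\<^sub>m p m" "h' * C = 0\<^sub>m p m'"
    using 0(1) copair_eq_0_iff[of "h * A" p m "h' * C" m'] h h' carr
    by (simp_all add: gh copair_mult_block_diag[OF h h' carr(1,3)])
  moreover have "h * B = 0\<^sub>m p n" "h' * D = 0\<^sub>m p n'"
    using 0(2) copair_eq_0_iff[of "h * B" p n "h' * D" n'] h h' carr
    by (simp_all add: gh copair_mult_block_diag[OF h h' carr(2,4)])
  ultimately have "h = 0\<^sub>m p d" "h' = 0\<^sub>m p d'"
    using AB CD h h' unfolding jointly_epic_iff by blast+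
  then show "g = 0\<^sub>m p (d + d')" by (simp add: gh)
qed (use jointly_epic_carrier[OF AB] jointly_epic_carrier[OF CD] in auto)

lemma Tns_Corel_Mat:
  assumes S: "S \<in> LTI_behaviours m n" and T: "T \<in> LTI_behaviours m' n'"
  shows "Tns Corel_Mat (corel_of m n S) (corel_of m' n' T) =
    corel_of (m + m') (n + n') (Tns LTI S T)"
proof -
  have cls: "corel_class (block_diag A C) (block_diag B D) =
      corel_of (m + m') (n + n') (Tns LTI S T)"
    if "(A, B) \<in> corel_of m n S" "(C, D) \<in> corel_of m' n' T" for A B C D
  proof -
    obtain d d' where AB: "jointly_epic m n d A B" "behaviour_of A B = S"
      and CD: "jointly_epic m' n' d' C D" "behaviour_of C D = T"
      using \<open>(A, B) \<in> corel_of m n S\<close> \<open>(C, D) \<in> corel_of m' n' T\<close> by (auto simp: corel_of_def)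
    show ?thesis
      unfolding corel_class_eq[OF jointly_epic_block_diag[OF AB(1) CD(1)]]
        behaviour_of_block_diag[OF jointly_epic_carrier[OF AB(1)] jointly_epic_carrier[OF CD(1)]]
        AB(2) CD(2) ..
  qed
  \<comment> \<open>The product is a union of equal classes; one pair of representatives ensures
    that the union is not over an empty family.\<close>
  obtain A B C D where "(A, B) \<in> corel_of m n S" "(C, D) \<in> corel_of m' n' T"
    using corel_of_nonempty[OF S] corel_of_nonempty[OF T] by fast
  then have wit: "X \<in> corel_of (m + m') (n + n') (Tns LTI S T) \<Longrightarrow>
      X \<in> Tns Corel_Mat (corel_of m n S) (corel_of m' n' T)" for X
    unfolding Corel_Mat_def Mat_def prop_data.simps
    by (intro UN_I[of "(A, B)"]) (auto simp: cls intro!: bexI[of _ "(C, D)"])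
  show ?thesis
  proof (intro equalityI subsetI wit)
    fix X assume "X \<in> Tns Corel_Mat (corel_of m n S) (corel_of m' n' T)"
    then show "X \<in> corel_of (m + m') (n + n') (Tns LTI S T)"
      using cls by (auto simp: Corel_Mat_def Mat_def)
  qed
qed

lemma jointly_epic_one:
  assumes "A \<in> carrier_mat n m"
  shows "jointly_epic m n n A (1\<^sub>m n)"
  using assms by (auto simp: jointly_epic_iff)

lemma Idn_Corel_Mat: "Idn Corel_Mat n = corel_of n n (Idn LTI n)"
  unfolding behaviour_of_one[symmetric] corel_class_eq[OF jointly_epic_one[OF one_carrier_mat], symmetric]
  by (simp add: Corel_Mat_def Mat_def)

lemma Sym_Corel_Mat: "Sym Corel_Mat m n = corel_of (m + n) (n + m) (Sym LTI m n)"
  unfolding behaviour_of_swap[symmetric]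
    corel_class_eq[OF jointly_epic_one[OF swap_mat_carrier], symmetric]
  by (simp add: Corel_Mat_def Mat_def)

text \<open>All members of a class share one behaviour, so a union evaluates the class without
  choosing a representative. Nonemptiness of the class is what returns \<open>S\<close> instead of
  the empty set.\<close>

lemma Union_behaviour_corel_of:
  assumes "S \<in> LTI_behaviours m n"
  shows "(\<Union>(A, B)\<in>corel_of m n S. behaviour_of A B) = S"
proof -
  have "behaviour_of A B = S" if "(A, B) \<in> corel_of m n S" for A B
    using that by (auto simp: corel_of_def)
  then show ?thesis using corel_of_nonempty[OF assms] by fast
qed

theorem theorem4p9:
  shows "\<exists>\<Phi> :: nat \<Rightarrow> nat \<Rightarrow> 'k::field cospan set \<Rightarrow> 'k behaviour.
    prop_isomorphism Corel_Mat LTI \<Phi> \<and>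
    (\<forall>m n d A B. jointly_epic m n d A B \<longrightarrow>
       \<Phi> m n (corel_class A B) = {(x, y) \<in> traj m \<times> traj n. theta A x = theta B y} \<and>
       (\<lambda>(x, y). traj_join x y) ` \<Phi> m n (corel_class A B) = ker_theta (copair A (- B)))"
proof (intro exI conjI allI impI)
  let ?\<Phi> = "\<lambda>(m::nat) (n::nat) X :: 'k cospan set. \<Union>(A, B)\<in>X. behaviour_of A B"
  show "prop_isomorphism Corel_Mat LTI ?\<Phi>"
  \<comment> \<open>The inverse sends a behaviour to the set of all jointly epic cospans
    representing it, so it too requires no choice.\<close>
  proof (rule prop_isomorphism_transport[where G = corel_of])
    show "Hom Corel_Mat m n \<inter> Hom Corel_Mat m' n' = ({} :: 'k cospan set set)"
      if "(m, n) \<noteq> (m', n')" for m n m' n'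
      using that by (rule Hom_Corel_Mat_disjoint)
  qed (simp_all only: prop_category_LTI Hom_LTI Hom_Corel_Mat Union_behaviour_corel_of
      Cmp_Corel_Mat Idn_Corel_Mat Tns_Corel_Mat Sym_Corel_Mat)
  fix m n d and A B :: "'k laurent mat"
  assume je: "jointly_epic m n d A B"
  note AB = jointly_epic_carrier[OF je]
  have \<Phi>: "?\<Phi> m n (corel_class A B) = behaviour_of A B"
    unfolding corel_class_eq[OF je] by (rule Union_behaviour_corel_of[OF LTI_behaviour_of[OF AB]])
  show "?\<Phi> m n (corel_class A B) = {(x, y) \<in> traj m \<times> traj n. theta A x = theta B y}"
    unfolding \<Phi> using AB by (auto simp: behaviour_of_def)
  show "(\<lambda>(x, y). traj_join x y) ` ?\<Phi> m n (corel_class A B) = ker_theta (copair A (- B))"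
    unfolding \<Phi> by (rule traj_join_behaviour_of[OF AB])
qed

end
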